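(* Let $\Gamma$ be a finite simplicial graph with vertex set $V\Gamma$ and let $\mathfrak{G}=\{G_v\mid v\in V\Gamma\}$ be a collection of groups. If each of the groups $G_v$, $v\in V\Gamma$, satisfies property (VRC), then so does the graph product $G=\Gamma\mathfrak{G}$.
   Context: A subgroup $H$ of a group $K$ is a retract of $K$ if there is a homomorphism $\rho: K \to H$ which restricts to the identity map on $H$. A subgroup $H$ of a group $G$ is a virtual retract of $G$ if there exists a subgroup $K \leqslant G$ with $|G:K|<\infty$, $H \subseteq K$, and $H$ a retract of $K$. A group $G$ has property (VRC) if every cyclic subgroup of $G$ is a virtual retract of $G$. Given a simplicial graph $\Gamma$ with vertex set $V\Gamma$ and edge set $E\Gamma$ and a family of groups $\mathfrak{G}=\{G_v\mid v\in V\Gamma\}$, the graph product $\Gamma\mathfrak{G}$ is the quotient of the free product $\ast_{v\in V\Gamma}G_v$ by the relations $[g_u,g_v]=1$ for all $g_u\in G_u$, $g_v\in G_v$ whenever $(u,v)\in E\Gamma$. *)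

theory Defs
  imports "HOL-Algebra.Elementary_Groups" "Graph_Theory.Pair_Digraph"
begin

section \<open>Virtual retracts and property (VRC)\<close>

definition group_retract :: "'a set \<Rightarrow> ('a, 'b) monoid_scheme \<Rightarrow> bool" where
  "group_retract H K \<longleftrightarrow>
     subgroup H K \<and> (\<exists>\<rho> \<in> hom K (K\<lparr>carrier := H\<rparr>). \<forall>h\<in>H. \<rho> h = h)"

definition virtual_retract :: "'a set \<Rightarrow> ('a, 'b) monoid_scheme \<Rightarrow> bool" where
  "virtual_retract H G \<longleftrightarrow>
     subgroup H G \<and>
     (\<exists>K. subgroup K G \<and> finite (rcosets\<^bsub>G\<^esub> K) \<and> H \<subseteq> K \<and>
          group_retract H (G\<lparr>carrier := K\<rparr>))"

definition property_VRC :: "('a, 'b) monoid_scheme \<Rightarrow> bool" where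
  "property_VRC G \<longleftrightarrow>
     (\<forall>H. subgroup H G \<and> cyclic_group (G\<lparr>carrier := H\<rparr>) \<longrightarrow> virtual_retract H G)"

section \<open>Free products\<close>

text \<open>
  The free product of the groups \<open>G v\<close>, \<open>v \<in> V\<close>, is the set of words in the disjoint union
  of the carriers modulo the smallest congruence that deletes a letter which is the identity of
  its factor and multiplies two adjacent letters from the same factor.
\<close>

definition fp_words :: "'v set \<Rightarrow> ('v \<Rightarrow> ('a, 'b) monoid_scheme) \<Rightarrow> ('v \<times> 'a) list set" where
  "fp_words V G = lists (SIGMA v:V. carrier (G v))"

inductive_set fp_cong ::
    "'v set \<Rightarrow> ('v \<Rightarrow> ('a, 'b) monoid_scheme) \<Rightarrow> (('v \<times> 'a) list \<times> ('v \<times> 'a) list) set"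
  for V :: "'v set" and G :: "'v \<Rightarrow> ('a, 'b) monoid_scheme"
where
  refl: "x \<in> fp_words V G \<Longrightarrow> (x, x) \<in> fp_cong V G"
| sym: "(x, y) \<in> fp_cong V G \<Longrightarrow> (y, x) \<in> fp_cong V G"
| trans: "(x, y) \<in> fp_cong V G \<Longrightarrow> (y, z) \<in> fp_cong V G \<Longrightarrow> (x, z) \<in> fp_cong V G"
| one: "x \<in> fp_words V G \<Longrightarrow> y \<in> fp_words V G \<Longrightarrow> v \<in> V \<Longrightarrow>
    (x @ [(v, \<one>\<^bsub>G v\<^esub>)] @ y, x @ y) \<in> fp_cong V G"
| mult: "x \<in> fp_words V G \<Longrightarrow> y \<in> fp_words V G \<Longrightarrow> v \<in> V \<Longrightarrow>
    g \<in> carrier (G v) \<Longrightarrow> h \<in> carrier (G v) \<Longrightarrow>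
    (x @ [(v, g), (v, h)] @ y, x @ [(v, g \<otimes>\<^bsub>G v\<^esub> h)] @ y) \<in> fp_cong V G"

definition free_product ::
    "'v set \<Rightarrow> ('v \<Rightarrow> ('a, 'b) monoid_scheme) \<Rightarrow> ('v \<times> 'a) list set monoid" where
  "free_product V G =
     \<lparr>carrier = fp_words V G // fp_cong V G,
      monoid.mult = (\<lambda>X Y. \<Union>x\<in>X. \<Union>y\<in>Y. fp_cong V G `` {x @ y}),
      one = fp_cong V G `` {[]}\<rparr>"

definition fp_incl ::
    "'v set \<Rightarrow> ('v \<Rightarrow> ('a, 'b) monoid_scheme) \<Rightarrow> 'v \<Rightarrow> 'a \<Rightarrow> ('v \<times> 'a) list set" where
  "fp_incl V G v g = fp_cong V G `` {[(v, g)]}"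

section \<open>Graph products\<close>

definition normal_closure :: "('a, 'b) monoid_scheme \<Rightarrow> 'a set \<Rightarrow> 'a set" where
  "normal_closure G S = \<Inter>{N. N \<lhd> G \<and> S \<subseteq> N}"

definition commutator :: "('a, 'b) monoid_scheme \<Rightarrow> 'a \<Rightarrow> 'a \<Rightarrow> 'a" where
  "commutator G x y = x \<otimes>\<^bsub>G\<^esub> y \<otimes>\<^bsub>G\<^esub> inv\<^bsub>G\<^esub> x \<otimes>\<^bsub>G\<^esub> inv\<^bsub>G\<^esub> y"

text \<open>
  A finite simplicial graph is a \<^const>\<open>pair_graph\<close>: finitely many vertices, and a symmetric,
  irreflexive set \<^term>\<open>parcs \<Gamma>\<close> of pairs of vertices, so that each edge occurs in both
  orientations.
\<close>

definition graph_product_relators ::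
    "'v pair_pre_digraph \<Rightarrow> ('v \<Rightarrow> ('a, 'b) monoid_scheme) \<Rightarrow> ('v \<times> 'a) list set set" where
  "graph_product_relators \<Gamma> G =
     {commutator (free_product (pverts \<Gamma>) G)
        (fp_incl (pverts \<Gamma>) G u g) (fp_incl (pverts \<Gamma>) G v h) | u v g h.
        (u, v) \<in> parcs \<Gamma> \<and> g \<in> carrier (G u) \<and> h \<in> carrier (G v)}"

definition graph_product ::
    "'v pair_pre_digraph \<Rightarrow> ('v \<Rightarrow> ('a, 'b) monoid_scheme) \<Rightarrow> ('v \<times> 'a) list set set monoid" where
  "graph_product \<Gamma> G =
     free_product (pverts \<Gamma>) G Mod
       normal_closure (free_product (pverts \<Gamma>) G) (graph_product_relators \<Gamma> G)"

section \<open>Free products and graph products are groups\<close>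

lemma fp_words_Nil [simp]: "[] \<in> fp_words V G"
  and fp_words_Cons [simp]:
    "a # x \<in> fp_words V G \<longleftrightarrow> fst a \<in> V \<and> snd a \<in> carrier (G (fst a)) \<and> x \<in> fp_words V G"
  and fp_words_append [simp]: "x @ y \<in> fp_words V G \<longleftrightarrow> x \<in> fp_words V G \<and> y \<in> fp_words V G"
  by (cases a; auto simp: fp_words_def)+

lemma fp_cong_words:
  assumes "\<And>v. v \<in> V \<Longrightarrow> group (G v)" "(x, y) \<in> fp_cong V G"
  shows "x \<in> fp_words V G \<and> y \<in> fp_words V G"
  using assms(2)
proof (induction rule: fp_cong.induct)
  case (one x y v)
  then interpret group "G v" using assms(1) by simp
  show ?case using one by simp
next
  case (mult x y v g h)
  then interpret group "G v" using assms(1) by simp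
  show ?case using mult by simp
qed auto

lemma equiv_fp_cong:
  assumes "\<And>v. v \<in> V \<Longrightarrow> group (G v)"
  shows "equiv (fp_words V G) (fp_cong V G)"
proof (rule equivI)
  show "fp_cong V G \<subseteq> fp_words V G \<times> fp_words V G"
    using fp_cong_words[of V G, OF assms] by auto
  show "refl_on (fp_words V G) (fp_cong V G)"
    by (auto intro: refl_onI fp_cong.refl)
  show "sym_on UNIV (fp_cong V G)" by (auto intro: symI fp_cong.sym)
  show "trans_on UNIV (fp_cong V G)" by (auto intro: transI fp_cong.trans)
qed

lemma fp_cong_append_left:
  assumes "(x, y) \<in> fp_cong V G" "w \<in> fp_words V G"
  shows "(w @ x, w @ y) \<in> fp_cong V G"
  using assms(1)
proof (induction rule: fp_cong.induct)
  case (one x y v) then show ?case using fp_cong.one[of "w @ x" V G y v] assms(2) by simp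
next
  case (mult x y v g h)
  then show ?case using fp_cong.mult[of "w @ x" V G y v g h] assms(2) by simp
next
  case refl then show ?case using assms(2) by (intro fp_cong.refl) simp
next
  case sym then show ?case by (blast intro: fp_cong.sym)
next
  case trans then show ?case by (blast intro: fp_cong.trans)
qed

lemma fp_cong_append_right:
  assumes "(x, y) \<in> fp_cong V G" "w \<in> fp_words V G"
  shows "(x @ w, y @ w) \<in> fp_cong V G"
  using assms(1)
proof (induction rule: fp_cong.induct)
  case (one x y v) then show ?case using fp_cong.one[of x V G "y @ w" v] assms(2) by simp
next
  case (mult x y v g h)
  then show ?case using fp_cong.mult[of x V G "y @ w" v g h] assms(2) by simp
next
  case refl then show ?case using assms(2) by (intro fp_cong.refl) simp
next
  case sym then show ?case by (blast intro: fp_cong.sym)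
next
  case trans then show ?case by (blast intro: fp_cong.trans)
qed

lemma fp_mult_class:
  assumes "\<And>v. v \<in> V \<Longrightarrow> group (G v)" "x \<in> fp_words V G" "y \<in> fp_words V G"
  shows "fp_cong V G `` {x} \<otimes>\<^bsub>free_product V G\<^esub> fp_cong V G `` {y} = fp_cong V G `` {x @ y}"
proof -
  have eq: "equiv (fp_words V G) (fp_cong V G)" by (rule equiv_fp_cong) (rule assms(1))
  have "congruent2 (fp_cong V G) (fp_cong V G) (\<lambda>x y. fp_cong V G `` {x @ y})"
  proof (rule congruent2I'[of _ _])
    fix a a' b b' assume a: "(a, a') \<in> fp_cong V G" and b: "(b, b') \<in> fp_cong V G"
    have "(a @ b, a' @ b') \<in> fp_cong V G"
      using fp_cong_words[of V G, OF assms(1) a] fp_cong_words[of V G, OF assms(1) b]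
      by (intro fp_cong.trans[OF fp_cong_append_right[OF a] fp_cong_append_left[OF b]]) auto
    then show "fp_cong V G `` {a @ b} = fp_cong V G `` {a' @ b'}"
      by (rule equiv_class_eq[OF eq])
  qed
  from UN_equiv_class2[OF eq eq this assms(2,3)] show ?thesis
    by (simp add: free_product_def)
qed

lemma fp_carrierE:
  assumes "X \<in> carrier (free_product V G)"
  obtains x where "x \<in> fp_words V G" "X = fp_cong V G `` {x}"
  using assms by (auto simp: free_product_def quotient_def)

lemma fp_class_in_carrier:
  "x \<in> fp_words V G \<Longrightarrow> fp_cong V G `` {x} \<in> carrier (free_product V G)"
  by (auto simp: free_product_def quotient_def)

lemma fp_inverse_word:
  assumes "\<And>v. v \<in> V \<Longrightarrow> group (G v)" "x \<in> fp_words V G"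
  shows "\<exists>y \<in> fp_words V G. (y @ x, []) \<in> fp_cong V G"
  using assms(2)
proof (induction x)
  case Nil show ?case by (rule bexI[of _ "[]"]) (auto intro: fp_cong.refl)
next
  case (Cons a x)
  obtain v g where a: "a = (v, g)" by (cases a)
  with Cons.prems have v: "v \<in> V" and g: "g \<in> carrier (G v)" and x: "x \<in> fp_words V G" by auto
  then interpret group "G v" using assms(1) by simp
  from Cons.IH[OF x] obtain y where y: "y \<in> fp_words V G" "(y @ x, []) \<in> fp_cong V G" by blast
  let ?i = "inv\<^bsub>G v\<^esub> g"
  have "(y @ [(v, ?i), (v, g)] @ x, y @ [(v, \<one>\<^bsub>G v\<^esub>)] @ x) \<in> fp_cong V G"
    using fp_cong.mult[OF y(1) x v, of ?i g] g by simp
  moreover have "(y @ [(v, \<one>\<^bsub>G v\<^esub>)] @ x, y @ x) \<in> fp_cong V G"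
    using fp_cong.one[OF y(1) x v] .
  ultimately have "((y @ [(v, ?i)]) @ a # x, []) \<in> fp_cong V G"
    using fp_cong.trans[OF fp_cong.trans y(2)] by (simp add: a)
  moreover have "y @ [(v, ?i)] \<in> fp_words V G" using y g v by simp
  ultimately show ?case by blast
qed

lemma group_free_product:
  assumes G: "\<And>v. v \<in> V \<Longrightarrow> group (G v)"
  shows "group (free_product V G)"
proof (rule groupI)
  note [simp] = fp_mult_class[of V G, OF G]
  have one [simp]: "\<one>\<^bsub>free_product V G\<^esub> = fp_cong V G `` {[]}" by (simp add: free_product_def)
  show "\<one>\<^bsub>free_product V G\<^esub> \<in> carrier (free_product V G)" by (simp add: fp_class_in_carrier)
  fix X assume "X \<in> carrier (free_product V G)"
  then obtain x where x: "x \<in> fp_words V G" "X = fp_cong V G `` {x}" by (rule fp_carrierE)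
  then show "\<one>\<^bsub>free_product V G\<^esub> \<otimes>\<^bsub>free_product V G\<^esub> X = X" by simp
  obtain y where y: "y \<in> fp_words V G" "(y @ x, []) \<in> fp_cong V G"
    using fp_inverse_word[of V G, OF G x(1)] by blast
  have "fp_cong V G `` {y} \<otimes>\<^bsub>free_product V G\<^esub> X = \<one>\<^bsub>free_product V G\<^esub>"
    using x y equiv_class_eq[OF equiv_fp_cong[of V G, OF G] y(2)] by simp
  then show "\<exists>Y\<in>carrier (free_product V G). Y \<otimes>\<^bsub>free_product V G\<^esub> X = \<one>\<^bsub>free_product V G\<^esub>"
    using fp_class_in_carrier[OF y(1)] by blast
  fix Y assume "Y \<in> carrier (free_product V G)"
  then obtain y where y: "y \<in> fp_words V G" "Y = fp_cong V G `` {y}" by (rule fp_carrierE)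
  then show "X \<otimes>\<^bsub>free_product V G\<^esub> Y \<in> carrier (free_product V G)"
    using x by (simp add: fp_class_in_carrier)
  fix Z assume "Z \<in> carrier (free_product V G)"
  then obtain z where "z \<in> fp_words V G" "Z = fp_cong V G `` {z}" by (rule fp_carrierE)
  then show "X \<otimes>\<^bsub>free_product V G\<^esub> Y \<otimes>\<^bsub>free_product V G\<^esub> Z =
    X \<otimes>\<^bsub>free_product V G\<^esub> (Y \<otimes>\<^bsub>free_product V G\<^esub> Z)"
    using x y by simp
qed

lemma fp_incl_hom:
  assumes G: "\<And>v. v \<in> V \<Longrightarrow> group (G v)" and v: "v \<in> V"
  shows "fp_incl V G v \<in> hom (G v) (free_product V G)"
proof (rule homI)
  fix g assume g: "g \<in> carrier (G v)"
  then show "fp_incl V G v g \<in> carrier (free_product V G)"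
    using v by (simp add: fp_incl_def fp_class_in_carrier)
  fix h assume h: "h \<in> carrier (G v)"
  have "([(v, g), (v, h)], [(v, g \<otimes>\<^bsub>G v\<^esub> h)]) \<in> fp_cong V G"
    using fp_cong.mult[of "[]" V G "[]" v g h] g h v by simp
  from equiv_class_eq[OF equiv_fp_cong[of V G, OF G] this]
  show "fp_incl V G v (g \<otimes>\<^bsub>G v\<^esub> h) = fp_incl V G v g \<otimes>\<^bsub>free_product V G\<^esub> fp_incl V G v h"
    using v g h by (simp add: fp_incl_def fp_mult_class[of V G, OF G])
qed

lemma normal_normal_closure:
  assumes "group G" "S \<subseteq> carrier G"
  shows "normal_closure G S \<lhd> G"
proof -
  interpret group G by fact
  have ne: "carrier G \<in> {N. N \<lhd> G \<and> S \<subseteq> N}"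
    using assms(2) by (auto simp: normal_inv_iff subgroup_self)
  have "subgroup (\<Inter>{N. N \<lhd> G \<and> S \<subseteq> N}) G"
    using ne by (intro subgroups_Inter) (auto dest: normal_imp_subgroup)
  then show ?thesis
    unfolding normal_closure_def normal_inv_iff by blast
qed

lemma group_graph_product:
  assumes "pair_graph \<Gamma>" and G: "\<And>v. v \<in> pverts \<Gamma> \<Longrightarrow> group (G v)"
  shows "group (graph_product \<Gamma> G)"
proof -
  interpret pair_graph \<Gamma> by fact
  interpret F: group "free_product (pverts \<Gamma>) G" by (rule group_free_product[of _ G, OF G])
  let ?F = "free_product (pverts \<Gamma>) G"
  have incl: "fp_incl (pverts \<Gamma>) G v g \<in> carrier ?F"
    if "v \<in> pverts \<Gamma>" "g \<in> carrier (G v)" for v g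
    using that by (simp add: fp_incl_def fp_class_in_carrier)
  have "commutator ?F (fp_incl (pverts \<Gamma>) G u g) (fp_incl (pverts \<Gamma>) G v h) \<in> carrier ?F"
    if "(u, v) \<in> parcs \<Gamma>" "g \<in> carrier (G u)" "h \<in> carrier (G v)" for u v g h
    using incl[of u g] incl[of v h] arc_fst_in_verts[OF that(1)] arc_snd_in_verts[OF that(1)] that(2,3)
    by (simp add: commutator_def)
  then have "graph_product_relators \<Gamma> G \<subseteq> carrier ?F"
    by (auto simp: graph_product_relators_def)
  then show ?thesis
    unfolding graph_product_def
    by (intro normal.factorgroup_is_group normal_normal_closure F.is_group)
qed

end

theory Submission
  imports Defs "HOL-Number_Theory.Cong" "HOL-Algebra.Multiplicative_Group"
begin

text \<open>
  Induction on the number of vertices. Fix a vertex \<open>v\<close>, let \<open>A\<close> be the graph product over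
  \<open>\<Gamma> - v\<close> and \<open>L \<le> A\<close> its retract generated by the link of \<open>v\<close>, so that the graph product is the
  amalgam of \<open>A\<close> and \<open>L \<times> G\<^sub>v\<close> over \<open>L\<close>. Up to conjugation and shortening, an element lies in \<open>A\<close>,
  or in \<open>L \<times> G\<^sub>v\<close> (where the Chinese remainder theorem combines the retractions of the two
  coordinates), or is a product of syllables \<open>a s\<close> with \<open>a \<in> A - L\<close> and \<open>1 \<noteq> s \<in> G\<^sub>v\<close>. In the last case
  (VRC) makes \<open>A\<close> and \<open>G\<^sub>v\<close> residually finite and hence \<open>L\<close> separable in \<open>A\<close>, so there are finite
  quotients \<open>H\<close> of \<open>A\<close> and \<open>F\<close> of \<open>G\<^sub>v\<close> in which the syllables keep this form. The graph product then
  acts on \<open>\<int> \<times> F \<times> H\<close>, commuting with a free cofinite action of \<open>\<int>\<close> by shifts, so that the given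
  element translates a base point by one shift. The stabiliser of the shift orbit of that point
  has finite index and retracts onto the cyclic subgroup by the translation length.
\<close>

section \<open>Subgroups of finite index\<close>

lemma (in group) inv_cancel:
  assumes "x \<in> carrier G" "y \<in> carrier G"
  shows "x \<otimes> (inv x \<otimes> y) = y" "inv x \<otimes> (x \<otimes> y) = y"
  using assms by (simp_all flip: m_assoc)

lemma (in group) rcos_eq_iff:
  assumes "subgroup K G" "h \<in> carrier G" "h' \<in> carrier G"
  shows "K #> h = K #> h' \<longleftrightarrow> h \<otimes> inv h' \<in> K"
  by (metis assms is_group rcos_self repr_independence subgroup.rcos_module_imp subgroup.rcos_module_rev)

text \<open>Elements with the same value of \<open>c\<close> lie in one right coset, so choosing one
  element for each value in \<open>X\<close> meets every coset.\<close>

lemma (in group) finite_rcosetsI: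
  assumes K: "subgroup K G" and X: "finite X" "\<And>h. h \<in> carrier G \<Longrightarrow> c h \<in> X"
    and c: "\<And>h h'. h \<in> carrier G \<Longrightarrow> h' \<in> carrier G \<Longrightarrow> c h = c h' \<Longrightarrow> h \<otimes> inv h' \<in> K"
  shows "finite (rcosets K)"
proof (rule finite_surj[OF X(1)])
  let ?r = "\<lambda>p. SOME h. h \<in> carrier G \<and> c h = p"
  show "rcosets K \<subseteq> (\<lambda>p. K #> ?r p) ` X"
  proof
    fix C assume "C \<in> rcosets K"
    then obtain h where h: "h \<in> carrier G" "C = K #> h" by (auto simp: RCOSETS_def)
    have "?r (c h) \<in> carrier G \<and> c (?r (c h)) = c h"
      by (rule someI[of _ h]) (use h in simp)
    then have "C = K #> ?r (c h)"
      using c[of h "?r (c h)"] h rcos_eq_iff[OF K] by auto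
    then show "C \<in> (\<lambda>p. K #> ?r p) ` X" using X(2)[OF h(1)] by blast
  qed
qed

lemma (in group) rcos_in_rcosets:
  "h \<in> carrier G \<Longrightarrow> K #> h \<in> rcosets K"
  by (auto simp: RCOSETS_def)

text \<open>A chosen representative of \<open>K #> h\<close> moves \<open>h\<close> into
  \<open>K\<close>. The coset \<open>K #> h\<close>, together with the value of \<open>c\<close> at
  the moved element, then determines the coset of \<open>K0\<close>.\<close>

lemma (in group) finite_rcosets_trans:
  assumes K: "subgroup K G" "finite (rcosets K)" and K0: "subgroup K0 G"
    and X: "finite X" "\<And>h. h \<in> K \<Longrightarrow> c h \<in> X"
    and c: "\<And>h h'. h \<in> K \<Longrightarrow> h' \<in> K \<Longrightarrow> c h = c h' \<Longrightarrow> h \<otimes> inv h' \<in> K0"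
  shows "finite (rcosets K0)"
proof -
  interpret K: subgroup K G by fact
  define r where "r C = (SOME x. x \<in> C)" for C :: "'a set"
  have r: "r (K #> h) \<in> carrier G" "h \<otimes> inv r (K #> h) \<in> K" if h: "h \<in> carrier G" for h
  proof -
    have "r (K #> h) \<in> K #> h"
      unfolding r_def using rcos_self[OF h K(1)] by (rule someI)
    then show 1: "r (K #> h) \<in> carrier G" using K.elemrcos_carrier[OF is_group h] by blast
    show "h \<otimes> inv r (K #> h) \<in> K"
      using rcos_eq_iff[OF K(1) h 1] repr_independence[OF _ h K(1)] \<open>r (K #> h) \<in> K #> h\<close> by simp
  qed
  show ?thesis
  proof (rule finite_rcosetsI[OF K0, where X = "(rcosets K) \<times> X" and c = "\<lambda>h. (K #> h, c (h \<otimes> inv r (K #> h)))"])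
    show "finite ((rcosets K) \<times> X)" using K(2) X(1) by simp
    fix h assume h: "h \<in> carrier G"
    show "(K #> h, c (h \<otimes> inv r (K #> h))) \<in> (rcosets K) \<times> X"
      using r[OF h] X(2) rcos_in_rcosets[OF h] by simp
    fix h' assume h': "h' \<in> carrier G"
      and "(K #> h, c (h \<otimes> inv r (K #> h))) = (K #> h', c (h' \<otimes> inv r (K #> h')))"
    then have e: "K #> h = K #> h'" "c (h \<otimes> inv r (K #> h)) = c (h' \<otimes> inv r (K #> h))" by auto
    have "(h \<otimes> inv r (K #> h)) \<otimes> inv (h' \<otimes> inv r (K #> h)) \<in> K0"
      using c[OF _ _ e(2)] r[OF h] r[OF h'] e(1) by simp
    then show "h \<otimes> inv h' \<in> K0"
      using h h' r(1)[OF h] by (simp add: inv_mult_group m_assoc inv_cancel)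
  qed
qed

lemma (in group_hom) subgroup_preimage:
  assumes "subgroup K H" shows "subgroup {x \<in> carrier G. h x \<in> K} G"
proof -
  interpret K: subgroup K H by fact
  show ?thesis by (rule G.subgroupI) (auto intro!: exI[of _ \<one>])
qed

lemma (in group_hom) finite_rcosets_preimage:
  assumes K: "subgroup K H" "finite (rcosets\<^bsub>H\<^esub> K)"
  shows "finite (rcosets\<^bsub>G\<^esub> {x \<in> carrier G. h x \<in> K})"
proof (rule G.finite_rcosetsI[OF subgroup_preimage[OF K(1)] K(2), where c = "\<lambda>x. K #>\<^bsub>H\<^esub> h x"])
  fix x assume x: "x \<in> carrier G"
  then show "K #>\<^bsub>H\<^esub> h x \<in> rcosets\<^bsub>H\<^esub> K" by (simp add: H.rcos_in_rcosets)
  fix y assume y: "y \<in> carrier G" and "K #>\<^bsub>H\<^esub> h x = K #>\<^bsub>H\<^esub> h y"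
  then show "x \<otimes> inv y \<in> {x \<in> carrier G. h x \<in> K}"
    using x H.rcos_eq_iff[OF K(1)] by simp
qed

lemma (in group) finite_rcosets_Int:
  assumes K: "subgroup K G" "finite (rcosets K)" and L: "subgroup L G" "finite (rcosets L)"
  shows "finite (rcosets (K \<inter> L))"
proof (rule finite_rcosetsI[where X = "(rcosets K) \<times> (rcosets L)" and c = "\<lambda>h. (K #> h, L #> h)"])
  show "subgroup (K \<inter> L) G" using K L subgroups_Inter_pair by blast
qed (use assms rcos_in_rcosets rcos_eq_iff in auto)

text \<open>The kernel of the action on the right cosets of \<open>K\<close> by right multiplication
  will do: a finite set has only finitely many self-maps, so this kernel has finite index.\<close>

lemma (in group) normal_core:
  assumes K: "subgroup K G" "finite (rcosets K)"
  shows "\<exists>N. N \<lhd> G \<and> finite (rcosets N) \<and> N \<subseteq> K"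
proof (intro exI conjI)
  let ?N = "{x \<in> carrier G. \<forall>y\<in>carrier G. y \<otimes> x \<otimes> inv y \<in> K}"
  interpret K: subgroup K G by fact
  have sub: "subgroup ?N G"
  proof (rule subgroupI)
    show "?N \<noteq> {}" by (auto intro!: exI[of _ \<one>])
    fix a assume a: "a \<in> ?N"
    have "y \<otimes> inv a \<otimes> inv y = inv (y \<otimes> a \<otimes> inv y)" if "y \<in> carrier G" for y
      using that a by (simp add: inv_mult_group m_assoc)
    then show "inv a \<in> ?N" using a by auto
    fix b assume b: "b \<in> ?N"
    have "y \<otimes> (a \<otimes> b) \<otimes> inv y = (y \<otimes> a \<otimes> inv y) \<otimes> (y \<otimes> b \<otimes> inv y)" if "y \<in> carrier G" for y
      using that a b by (simp add: m_assoc inv_solve_left)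
    then show "a \<otimes> b \<in> ?N" using a b by auto
  qed auto
  show "?N \<lhd> G"
    unfolding normal_inv_iff
  proof (intro conjI ballI)
    fix x h assume x: "x \<in> carrier G" and h: "h \<in> ?N"
    have "y \<otimes> (x \<otimes> h \<otimes> inv x) \<otimes> inv y = (y \<otimes> x) \<otimes> h \<otimes> inv (y \<otimes> x)" if "y \<in> carrier G" for y
      using that x h by (simp add: m_assoc inv_mult_group)
    then show "x \<otimes> h \<otimes> inv x \<in> ?N" using x h by auto
  qed (rule sub)
  show "finite (rcosets ?N)"
  proof (rule finite_rcosetsI[OF sub, where X = "rcosets K \<rightarrow>\<^sub>E rcosets K"
        and c = "\<lambda>h. \<lambda>C\<in>rcosets K. C #> h"])
    show "finite (rcosets K \<rightarrow>\<^sub>E rcosets K)" using K(2) by (intro finite_PiE) auto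
    fix h assume h: "h \<in> carrier G"
    show "(\<lambda>C\<in>rcosets K. C #> h) \<in> rcosets K \<rightarrow>\<^sub>E rcosets K"
      using h K.subset by (auto simp: RCOSETS_def coset_mult_assoc intro!: bexI[of _ "_ \<otimes> h"])
    fix h' assume h': "h' \<in> carrier G" and e: "(\<lambda>C\<in>rcosets K. C #> h) = (\<lambda>C\<in>rcosets K. C #> h')"
    have "y \<otimes> (h \<otimes> inv h') \<otimes> inv y \<in> K" if y: "y \<in> carrier G" for y
    proof -
      have "K #> (y \<otimes> h) = K #> (y \<otimes> h')"
        using fun_cong[OF e, of "K #> y"] rcos_in_rcosets[OF y] h h' y K.subset
        by (simp add: coset_mult_assoc)
      then have "(y \<otimes> h) \<otimes> inv (y \<otimes> h') \<in> K" using rcos_eq_iff[OF K(1)] h h' y by simp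
      then show ?thesis using h h' y by (simp add: inv_mult_group m_assoc)
    qed
    then show "h \<otimes> inv h' \<in> ?N" using h h' by auto
  qed
  show "?N \<subseteq> K" by (auto dest!: bspec[of _ _ \<one>])
qed

section \<open>Cyclic virtual retracts\<close>

text \<open>
  The retraction onto the subgroup generated by \<open>g\<close> is recorded by the exponents \<open>f x\<close> of the
  images; here \<open>k\<close> is the order of \<open>g\<close>, and \<open>k = 0\<close> covers the case of infinite order.
\<close>

definition cyclic_virtual_retract :: "('a, 'b) monoid_scheme \<Rightarrow> 'a \<Rightarrow> bool" where
  "cyclic_virtual_retract G g \<longleftrightarrow>
     (\<exists>K f (k::nat). subgroup K G \<and> finite (rcosets\<^bsub>G\<^esub> K) \<and> g \<in> K \<and> g [^]\<^bsub>G\<^esub> k = \<one>\<^bsub>G\<^esub> \<and>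
        (\<forall>x\<in>K. \<forall>y\<in>K. [f (x \<otimes>\<^bsub>G\<^esub> y) = f x + f y] (mod int k)) \<and> [f g = 1] (mod int k))"

lemma (in group) int_pow_cong:
  assumes "g \<in> carrier G" "g [^] (k::nat) = \<one>" "[i = j] (mod int k)"
  shows "g [^] i = g [^] j"
proof -
  have "int (ord g) dvd int k" using assms(1,2) pow_eq_id by auto
  then have "int (ord g) dvd j - i" using assms(3) by (metis cong_iff_dvd_diff cong_sym dvd_trans)
  then show ?thesis using int_pow_eq[OF assms(1)] by simp
qed

text \<open>The exponent of \<open>\<rho> x\<close> as a power of \<open>g\<close> is determined
  modulo \<open>ord g\<close>, which is 0 for infinite order. Any choice of exponents is therefore
  additive to that modulus.\<close>

lemma (in group) VRC_imp_cyclic_virtual_retract: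
  assumes "property_VRC G" and g: "g \<in> carrier G"
  shows "cyclic_virtual_retract G g"
proof -
  define H where "H = range (\<lambda>n::int. g [^] n)"
  have H: "subgroup H G"
    unfolding H_def
    by (rule subgroupI)
      (use g int_pow_neg int_pow_mult in \<open>auto intro: rangeI simp: image_iff simp flip: int_pow_neg int_pow_mult\<close>)
  have pow: "g [^]\<^bsub>G\<lparr>carrier := H\<rparr>\<^esub> n = g [^] n" for n :: int
    using int_pow_consistent[OF H, of g n] rangeI[of "\<lambda>n::int. g [^] n" 1] g by (simp add: H_def)
  have "g \<in> H" using rangeI[of "\<lambda>n::int. g [^] n" 1] g by (simp add: H_def)
  then have "cyclic_group (G\<lparr>carrier := H\<rparr>)"
    unfolding group.cyclic_group[OF subgroup.subgroup_is_group[OF H is_group]]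
    by (intro bexI[of _ g]) (simp_all add: pow, simp add: H_def)
  then obtain K \<rho> where K: "subgroup K G" "finite (rcosets K)" "H \<subseteq> K"
    and \<rho>: "\<rho> \<in> hom (G\<lparr>carrier := K\<rparr>) (G\<lparr>carrier := H\<rparr>)" "\<forall>h\<in>H. \<rho> h = h"
    using assms(1) H by (auto simp: property_VRC_def virtual_retract_def group_retract_def)
  define f where "f x = (SOME n::int. \<rho> x = g [^] n)" for x
  have f: "\<rho> x = g [^] f x" if "x \<in> K" for x
  proof -
    have "\<rho> x \<in> H" using \<rho>(1) that by (auto simp: hom_def)
    then have "\<exists>n::int. \<rho> x = g [^] n" by (auto simp: H_def)
    then show ?thesis unfolding f_def by (rule someI_ex)
  qed
  have cong: "[i = j] (mod int (ord g))" if "g [^] i = g [^] j" for i j :: int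
    using that int_pow_eq[OF g] by (metis cong_iff_dvd_diff cong_sym)
  show ?thesis
    unfolding cyclic_virtual_retract_def
  proof (intro exI conjI ballI)
    show "subgroup K G" "finite (rcosets K)" "g \<in> K" using K \<open>g \<in> H\<close> by auto
    show "g [^] ord g = \<one>" using g by simp
    show "[f g = 1] (mod int (ord g))"
      using f[of g] \<rho>(2) \<open>g \<in> H\<close> K g by (intro cong) auto
    fix x y assume x: "x \<in> K" and y: "y \<in> K"
    have "x \<otimes> y \<in> K" using K(1) x y by (rule subgroup.m_closed)
    then have "g [^] f (x \<otimes> y) = \<rho> x \<otimes> \<rho> y" using f hom_mult[OF \<rho>(1), of x y] x y by simp
    also have "\<dots> = g [^] (f x + f y)" using f x y g by (simp add: int_pow_mult)
    finally show "[f (x \<otimes> y) = f x + f y] (mod int (ord g))" by (rule cong)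
  qed
qed

text \<open>Powers of \<open>g\<close> depend only on the exponent modulo \<open>k\<close>, so
  sending \<open>x\<close> to \<open>g [^] f x\<close> is a homomorphism. It fixes \<open>g\<close>
  and hence every power of \<open>g\<close>.\<close>

lemma (in group) VRC_I:
  assumes "\<And>g. g \<in> carrier G \<Longrightarrow> cyclic_virtual_retract G g"
  shows "property_VRC G"
  unfolding property_VRC_def
proof (intro allI impI, elim conjE)
  fix H assume H: "subgroup H G" and "cyclic_group (G\<lparr>carrier := H\<rparr>)"
  then obtain g where g: "g \<in> H" "H = range (\<lambda>n::int. g [^]\<^bsub>G\<lparr>carrier := H\<rparr>\<^esub> n)"
    using group.cyclic_group[OF subgroup.subgroup_is_group[OF H is_group]] by auto
  have gc: "g \<in> carrier G" using H g(1) subgroup.subset by blast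
  have H_pow: "H = range (\<lambda>n::int. g [^] n)"
    using g int_pow_consistent[OF H g(1)] by auto
  obtain K f k where K: "subgroup K G" "finite (rcosets K)" "g \<in> K" and k: "g [^] (k::nat) = \<one>"
    and f: "\<And>x y. x \<in> K \<Longrightarrow> y \<in> K \<Longrightarrow> [f (x \<otimes> y) = f x + f y] (mod int k)"
      "[f g = 1] (mod int k)"
    using assms[OF gc] unfolding cyclic_virtual_retract_def by blast
  have sub: "H \<subseteq> K"
    unfolding H_pow using subgroup_int_pow_closed[OF K(1,3)] by auto
  have hom: "(\<lambda>x. g [^] f x) \<in> hom (G\<lparr>carrier := K\<rparr>) (G\<lparr>carrier := H\<rparr>)"
    by (rule homI) (use int_pow_cong[OF gc k f(1)] gc in \<open>auto simp: H_pow int_pow_mult\<close>)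
  have gg: "g [^] f g = g" using int_pow_cong[OF gc k f(2)] gc by simp
  interpret K: group "G\<lparr>carrier := K\<rparr>" using K(1) is_group by (rule subgroup.subgroup_is_group)
  interpret H: group "G\<lparr>carrier := H\<rparr>" using H is_group by (rule subgroup.subgroup_is_group)
  have "g [^] f (g [^] n) = g [^] n" for n :: int
    using hom_int_pow[OF hom, of g n] K(3) gg int_pow_consistent[OF K(1,3)]
      int_pow_consistent[OF H g(1)] K.is_group H.is_group by simp
  then have "group_retract H (G\<lparr>carrier := K\<rparr>)"
    unfolding group_retract_def using subgroup_incl[OF H K(1) sub] hom
    by (intro conjI bexI[of _ "\<lambda>x. g [^] f x"]) (auto simp: H_pow)
  then show "virtual_retract H G"
    unfolding virtual_retract_def using K(1,2) sub H by blast
qed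

text \<open>Both \<open>K\<close> and the exponent function are pulled back along \<open>r\<close>,
  while \<open>j\<close> carries over the relation on the \<open>k\<close>-th power. This serves for
  conjugations and for retracts of a larger group.\<close>

lemma cyclic_virtual_retract_pullback:
  assumes "group G" "group H" "r \<in> hom G H" "j \<in> hom H G" "h \<in> carrier H" "r (j h) = h"
    and "cyclic_virtual_retract H h"
  shows "cyclic_virtual_retract G (j h)"
proof -
  interpret r: group_hom G H r using assms by (simp add: group_hom_def group_hom_axioms_def)
  interpret j: group_hom H G j using assms by (simp add: group_hom_def group_hom_axioms_def)
  obtain K f k where K: "subgroup K H" "finite (rcosets\<^bsub>H\<^esub> K)" "h \<in> K"
    and k: "h [^]\<^bsub>H\<^esub> (k::nat) = \<one>\<^bsub>H\<^esub>"
    and f: "\<And>x y. x \<in> K \<Longrightarrow> y \<in> K \<Longrightarrow> [f (x \<otimes>\<^bsub>H\<^esub> y) = f x + f y] (mod int k)"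
      "[f h = 1] (mod int k)"
    using assms(7) unfolding cyclic_virtual_retract_def by blast
  show ?thesis
    unfolding cyclic_virtual_retract_def
  proof (intro exI conjI ballI)
    show "subgroup {x \<in> carrier G. r x \<in> K} G" by (rule r.subgroup_preimage[OF K(1)])
    show "finite (rcosets\<^bsub>G\<^esub> {x \<in> carrier G. r x \<in> K})"
      by (rule r.finite_rcosets_preimage[OF K(1,2)])
    show "j h \<in> {x \<in> carrier G. r x \<in> K}" using assms(5,6) K(3) by simp
    show "j h [^]\<^bsub>G\<^esub> k = \<one>\<^bsub>G\<^esub>" using k assms(5) j.hom_nat_pow[of h k] by simp
    show "[f (r (j h)) = 1] (mod int k)" using f(2) assms(6) by simp
  qed (use f(1) in auto)
qed

text \<open>The two products are conjugate by \<open>y\<close>.\<close>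

lemma (in group) cyclic_virtual_retract_swap:
  assumes "cyclic_virtual_retract G (x \<otimes> y)" "x \<in> carrier G" "y \<in> carrier G"
  shows "cyclic_virtual_retract G (y \<otimes> x)"
proof -
  have "cyclic_virtual_retract G ((\<lambda>z. y \<otimes> z \<otimes> inv y) (x \<otimes> y))"
  proof (rule cyclic_virtual_retract_pullback[OF is_group is_group, where r = "\<lambda>z. inv y \<otimes> z \<otimes> y"
        and j = "\<lambda>z. y \<otimes> z \<otimes> inv y" and h = "x \<otimes> y"])
    show "(\<lambda>z. inv y \<otimes> z \<otimes> y) \<in> hom G G" and "(\<lambda>z. y \<otimes> z \<otimes> inv y) \<in> hom G G"
      using assms by (auto intro!: homI simp: m_assoc inv_cancel)
  qed (use assms in \<open>auto simp: m_assoc inv_cancel\<close>)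
  moreover have "y \<otimes> (x \<otimes> y) \<otimes> inv y = y \<otimes> x" using assms by (simp add: m_assoc)
  ultimately show ?thesis by simp
qed

lemma (in group) cyclic_virtual_retract_one: "cyclic_virtual_retract G \<one>"
  unfolding cyclic_virtual_retract_def
proof (intro exI conjI ballI)
  show "finite (rcosets (carrier G))"
    by (rule finite_rcosetsI[OF subgroup_self, where c = "\<lambda>_. ()" and X = UNIV]) auto
  \<comment> \<open>Modulus 1 makes both congruences trivial for any exponent function.\<close>
  show "\<one> [^] (1::nat) = \<one>" by simp
qed (auto simp: subgroup_self)

section \<open>Separating elements by normal subgroups of finite index\<close>

text \<open>This is the kernel of the homomorphism from \<open>K\<close> to the integers modulo
  \<open>p\<close> induced by \<open>f\<close>, so its index in \<open>K\<close> is at most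
  \<open>p\<close>.\<close>

lemma (in group) mod_hom_kernel:
  assumes K: "subgroup K G" "finite (rcosets K)" and p: "p > 0"
    and f: "\<And>x y. x \<in> K \<Longrightarrow> y \<in> K \<Longrightarrow> [f (x \<otimes> y) = f x + f y] (mod (p::int))"
  shows "subgroup {x \<in> K. [f x = 0] (mod p)} G" (is "subgroup ?K0 G")
    and "finite (rcosets {x \<in> K. [f x = 0] (mod p)})"
proof -
  interpret K: subgroup K G by fact
  have one: "[f \<one> = 0] (mod p)"
    using f[of \<one> \<one>] by (simp add: cong_iff_dvd_diff)
  have inv: "[f (inv x) = - f x] (mod p)" if "x \<in> K" for x
  proof -
    have "[f x + f (inv x) = f \<one>] (mod p)"
      using f[of x "inv x"] that K.mem_carrier[OF that] by (simp add: cong_sym)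
    from cong_trans[OF this one] show ?thesis
      by (simp add: cong_iff_dvd_diff add.commute)
  qed
  show sub: "subgroup ?K0 G"
  proof (rule subgroupI)
    show "?K0 \<noteq> {}" using one by (auto intro!: exI[of _ \<one>])
    show "inv x \<in> ?K0" if "x \<in> ?K0" for x
      using that cong_trans[OF inv, of x 0] by (auto simp: cong_minus_minus_iff[of _ 0, simplified])
    show "x \<otimes> y \<in> ?K0" if "x \<in> ?K0" "y \<in> ?K0" for x y
      using that cong_trans[OF f, of x y 0] cong_add[of "f x" 0 p "f y" 0] by auto
  qed auto
  show "finite (rcosets ?K0)"
  proof (rule finite_rcosets_trans[OF K sub, where X = "{0..<p}" and c = "\<lambda>x. f x mod p"])
    fix x y assume xy: "x \<in> K" "y \<in> K" "f x mod p = f y mod p"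
    have "[f (x \<otimes> inv y) = f x + f (inv y)] (mod p)" using f xy by simp
    also have "[f x + f (inv y) = f y + - f y] (mod p)"
      using xy inv[of y] by (intro cong_add) (simp_all add: cong_def)
    finally show "x \<otimes> inv y \<in> ?K0" using xy by simp
  qed (use p in auto)
qed

text \<open>The exponent function takes the value 1 at \<open>g\<close>. Its reduction modulo a
  suitable \<open>p \<ge> 2\<close> has a kernel of finite index that misses \<open>g\<close>, and
  the normal core of this kernel is the required subgroup.\<close>

lemma (in group) cyclic_virtual_retract_separates:
  assumes "cyclic_virtual_retract G g" "g \<in> carrier G" "g \<noteq> \<one>"
  shows "\<exists>N. N \<lhd> G \<and> finite (rcosets N) \<and> g \<notin> N"
proof -
  obtain K f k where K: "subgroup K G" "finite (rcosets K)" and k: "g [^] (k::nat) = \<one>"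
    and f: "\<And>x y. x \<in> K \<Longrightarrow> y \<in> K \<Longrightarrow> [f (x \<otimes> y) = f x + f y] (mod int k)"
      "[f g = 1] (mod int k)"
    using assms(1) unfolding cyclic_virtual_retract_def by blast
  \<comment> \<open>If \<open>k = 0\<close>, every modulus divides \<open>k\<close> and 2 is taken.
    Otherwise \<open>k\<close> itself serves, since \<open>k = 1\<close> would force
    \<open>g = \<one>\<close>.\<close>
  define p where "p = (if k = 0 then 2 else int k)"
  have "k \<noteq> 1" using k assms(2,3) by auto
  then have p: "p \<ge> 2" "p dvd int k" by (auto simp: p_def)
  let ?K0 = "{x \<in> K. [f x = 0] (mod p)}"
  have "p > 0" using p by simp
  note K0 = mod_hom_kernel[OF K this, of f, OF cong_dvd_modulus[OF f(1) p(2)]]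
  have "g \<notin> ?K0"
  proof
    assume "g \<in> ?K0"
    then have "[1 = 0] (mod p)"
      using cong_dvd_modulus[OF f(2) p(2)] by (auto intro: cong_trans cong_sym)
    then show False using p(1) by (simp add: cong_def)
  qed
  then show ?thesis using normal_core[OF K0] by blast
qed

lemma (in group) normal_Int:
  assumes "M \<lhd> G" "N \<lhd> G" shows "M \<inter> N \<lhd> G"
  using assms subgroups_Inter_pair[of M N] unfolding normal_inv_iff by auto

lemma (in group) cyclic_virtual_retracts_separate_finite:
  assumes D: "\<And>g. g \<in> carrier G \<Longrightarrow> cyclic_virtual_retract G g"
    and S: "finite S" "S \<subseteq> carrier G" "\<one> \<notin> S"
  shows "\<exists>N. N \<lhd> G \<and> finite (rcosets N) \<and> N \<inter> S = {}"
  using S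
proof (induction S rule: finite_induct)
  case empty
  have "finite (rcosets (carrier G))"
    by (rule finite_rcosetsI[OF subgroup_self, where c = "\<lambda>_. ()" and X = UNIV]) auto
  then show ?case using subgroup_self by (auto simp: normal_inv_iff)
next
  case (insert g S)
  then obtain N where N: "N \<lhd> G" "finite (rcosets N)" "N \<inter> S = {}" by auto
  obtain M where M: "M \<lhd> G" "finite (rcosets M)" "g \<notin> M"
    using cyclic_virtual_retract_separates[of g] D insert.prems by auto
  have "finite (rcosets (M \<inter> N))"
    using N M by (intro finite_rcosets_Int) (auto simp: normal_imp_subgroup)
  then show ?case using normal_Int[OF M(1) N(1)] N M by blast
qed

section \<open>Combining two retractions by the Chinese remainder theorem\<close>

text \<open>By Bezout some \<open>m * t\<close> is congruent to the gcd modulo \<open>n\<close>.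
  Adding the right multiple of it to \<open>a\<close> reaches \<open>b\<close> modulo
  \<open>n\<close> and leaves the residue modulo \<open>m\<close> unchanged.\<close>

lemma crt_lcm:
  fixes a b :: int
  assumes "[a = b] (mod gcd m n)"
  shows "\<exists>z. [z = a] (mod m) \<and> [z = b] (mod n)"
proof -
  obtain t where t: "[m * t = gcd m n] (mod n)" using cong_solve_int by blast
  obtain q where q: "b - a = gcd m n * q"
    using assms by (metis cong_iff_dvd_diff cong_sym dvdE)
  have "[m * t * q = b - a] (mod n)" using cong_scalar_right[OF t, of q] q by simp
  then have "[a + m * t * q = a + (b - a)] (mod n)" by (rule cong_add[OF cong_refl])
  then show ?thesis
    by (intro exI[of _ "a + m * t * q"]) (simp add: cong_iff_dvd_diff mult.assoc)
qed

text \<open>On the subgroup where the two exponents agree modulo the gcd of the orders, they merge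
  into one exponent modulo the lcm; by \<open>pow\<close> the element \<open>g\<close> is killed by
  that lcm.\<close>

lemma cyclic_virtual_retract_prod:
  assumes "group G" "group H\<^sub>1" "group H\<^sub>2" "\<psi>\<^sub>1 \<in> hom G H\<^sub>1" "\<psi>\<^sub>2 \<in> hom G H\<^sub>2" and g: "g \<in> carrier G"
    and D: "cyclic_virtual_retract H\<^sub>1 (\<psi>\<^sub>1 g)" "cyclic_virtual_retract H\<^sub>2 (\<psi>\<^sub>2 g)"
    and pow: "\<And>n::nat. \<psi>\<^sub>1 g [^]\<^bsub>H\<^sub>1\<^esub> n = \<one>\<^bsub>H\<^sub>1\<^esub> \<Longrightarrow> \<psi>\<^sub>2 g [^]\<^bsub>H\<^sub>2\<^esub> n = \<one>\<^bsub>H\<^sub>2\<^esub> \<Longrightarrow> g [^]\<^bsub>G\<^esub> n = \<one>\<^bsub>G\<^esub>"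
  shows "cyclic_virtual_retract G g"
proof -
  interpret \<psi>\<^sub>1: group_hom G H\<^sub>1 \<psi>\<^sub>1 using assms by (simp add: group_hom_def group_hom_axioms_def)
  interpret \<psi>\<^sub>2: group_hom G H\<^sub>2 \<psi>\<^sub>2 using assms by (simp add: group_hom_def group_hom_axioms_def)
  obtain K\<^sub>1 f\<^sub>1 k\<^sub>1 where K1: "subgroup K\<^sub>1 H\<^sub>1" "finite (rcosets\<^bsub>H\<^sub>1\<^esub> K\<^sub>1)" "\<psi>\<^sub>1 g \<in> K\<^sub>1"
    and k1: "\<psi>\<^sub>1 g [^]\<^bsub>H\<^sub>1\<^esub> (k\<^sub>1::nat) = \<one>\<^bsub>H\<^sub>1\<^esub>"
    and f1: "\<And>x y. x \<in> K\<^sub>1 \<Longrightarrow> y \<in> K\<^sub>1 \<Longrightarrow> [f\<^sub>1 (x \<otimes>\<^bsub>H\<^sub>1\<^esub> y) = f\<^sub>1 x + f\<^sub>1 y] (mod int k\<^sub>1)"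
      "[f\<^sub>1 (\<psi>\<^sub>1 g) = 1] (mod int k\<^sub>1)"
    using D(1) unfolding cyclic_virtual_retract_def by blast
  obtain K\<^sub>2 f\<^sub>2 k\<^sub>2 where K2: "subgroup K\<^sub>2 H\<^sub>2" "finite (rcosets\<^bsub>H\<^sub>2\<^esub> K\<^sub>2)" "\<psi>\<^sub>2 g \<in> K\<^sub>2"
    and k2: "\<psi>\<^sub>2 g [^]\<^bsub>H\<^sub>2\<^esub> (k\<^sub>2::nat) = \<one>\<^bsub>H\<^sub>2\<^esub>"
    and f2: "\<And>x y. x \<in> K\<^sub>2 \<Longrightarrow> y \<in> K\<^sub>2 \<Longrightarrow> [f\<^sub>2 (x \<otimes>\<^bsub>H\<^sub>2\<^esub> y) = f\<^sub>2 x + f\<^sub>2 y] (mod int k\<^sub>2)"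
      "[f\<^sub>2 (\<psi>\<^sub>2 g) = 1] (mod int k\<^sub>2)"
    using D(2) unfolding cyclic_virtual_retract_def by blast
  let ?L1 = "{x \<in> carrier G. \<psi>\<^sub>1 x \<in> K\<^sub>1}" and ?L2 = "{x \<in> carrier G. \<psi>\<^sub>2 x \<in> K\<^sub>2}"
  note L1 = \<psi>\<^sub>1.subgroup_preimage[OF K1(1)] \<psi>\<^sub>1.finite_rcosets_preimage[OF K1(1,2)]
  note L2 = \<psi>\<^sub>2.subgroup_preimage[OF K2(1)] \<psi>\<^sub>2.finite_rcosets_preimage[OF K2(1,2)]
  consider "k\<^sub>1 = 0" | "k\<^sub>2 = 0" | "k\<^sub>1 > 0" "k\<^sub>2 > 0" by blast
  then show ?thesis
  proof cases
    \<comment> \<open>Modulus 0 means genuine integer exponents, so the pullback along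
      \<open>\<psi>\<^sub>1\<close> alone suffices.\<close>
    case 1
    then show ?thesis
      unfolding cyclic_virtual_retract_def using L1 K1(3) f1 g
      by (intro exI[of _ ?L1] exI[of _ "\<lambda>x. f\<^sub>1 (\<psi>\<^sub>1 x)"] exI[of _ 0]) auto
  next
    case 2
    then show ?thesis
      unfolding cyclic_virtual_retract_def using L2 K2(3) f2 g
      by (intro exI[of _ ?L2] exI[of _ "\<lambda>x. f\<^sub>2 (\<psi>\<^sub>2 x)"] exI[of _ 0]) auto
  next
    case 3
    let ?L = "?L1 \<inter> ?L2"
    define d where "d = gcd (int k\<^sub>1) (int k\<^sub>2)"
    have d: "d > 0" "d dvd int k\<^sub>1" "d dvd int k\<^sub>2" using 3 by (auto simp: d_def)
    let ?e = "\<lambda>x. f\<^sub>1 (\<psi>\<^sub>1 x) - f\<^sub>2 (\<psi>\<^sub>2 x)"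
    have L: "subgroup ?L G" "finite (rcosets\<^bsub>G\<^esub> ?L)"
      using L1 L2 \<psi>\<^sub>1.G.subgroups_Inter_pair \<psi>\<^sub>1.G.finite_rcosets_Int by blast+
    have e: "[?e (x \<otimes>\<^bsub>G\<^esub> y) = ?e x + ?e y] (mod d)" if "x \<in> ?L" "y \<in> ?L" for x y
      using cong_diff[OF cong_dvd_modulus[OF f1(1) d(2)] cong_dvd_modulus[OF f2(1) d(3)],
          of "\<psi>\<^sub>1 x" "\<psi>\<^sub>1 y" "\<psi>\<^sub>2 x" "\<psi>\<^sub>2 y"] that by (simp add: algebra_simps)
    \<comment> \<open>Agreement modulo \<open>d\<close> is exactly the condition under which the two
      congruences for \<open>f x\<close> are solvable.\<close>
    let ?K = "{x \<in> ?L. [?e x = 0] (mod d)}"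
    note K = \<psi>\<^sub>1.G.mod_hom_kernel[OF L d(1), of ?e, OF e]
    define f where "f x = (SOME z. [z = f\<^sub>1 (\<psi>\<^sub>1 x)] (mod int k\<^sub>1) \<and> [z = f\<^sub>2 (\<psi>\<^sub>2 x)] (mod int k\<^sub>2))" for x
    have f: "[f x = f\<^sub>1 (\<psi>\<^sub>1 x)] (mod int k\<^sub>1)" "[f x = f\<^sub>2 (\<psi>\<^sub>2 x)] (mod int k\<^sub>2)" if "x \<in> ?K" for x
    proof -
      have "[f\<^sub>1 (\<psi>\<^sub>1 x) = f\<^sub>2 (\<psi>\<^sub>2 x)] (mod d)"
        using that by (simp add: cong_diff_iff_cong_0)
      from crt_lcm[OF this[unfolded d_def]]
      have "[f x = f\<^sub>1 (\<psi>\<^sub>1 x)] (mod int k\<^sub>1) \<and> [f x = f\<^sub>2 (\<psi>\<^sub>2 x)] (mod int k\<^sub>2)"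
        unfolding f_def by (rule someI_ex)
      then show "[f x = f\<^sub>1 (\<psi>\<^sub>1 x)] (mod int k\<^sub>1)" "[f x = f\<^sub>2 (\<psi>\<^sub>2 x)] (mod int k\<^sub>2)" by auto
    qed
    \<comment> \<open>The value \<open>f x\<close> is unique modulo the lcm, so additivity can be
      checked modulo each order separately.\<close>
    have lcm: "[a = b] (mod int (lcm k\<^sub>1 k\<^sub>2))" if "[a = b] (mod int k\<^sub>1)" "[a = b] (mod int k\<^sub>2)" for a b
      using that by (simp add: cong_iff_dvd_diff flip: lcm_int_int_eq)
    have gK: "g \<in> ?K"
      using cong_diff[OF cong_dvd_modulus[OF f1(2) d(2)] cong_dvd_modulus[OF f2(2) d(3)]] K1(3) K2(3) g
      by simp
    show ?thesis
      unfolding cyclic_virtual_retract_def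
    proof (intro exI conjI ballI)
      show "subgroup ?K G" "finite (rcosets\<^bsub>G\<^esub> ?K)" "g \<in> ?K" using K gK by auto
      have "\<psi>\<^sub>1 g [^]\<^bsub>H\<^sub>1\<^esub> lcm k\<^sub>1 k\<^sub>2 = \<one>\<^bsub>H\<^sub>1\<^esub>"
        using k1 g dvd_trans[OF _ dvd_lcm1] by (auto simp: \<psi>\<^sub>1.H.pow_eq_id)
      moreover have "\<psi>\<^sub>2 g [^]\<^bsub>H\<^sub>2\<^esub> lcm k\<^sub>1 k\<^sub>2 = \<one>\<^bsub>H\<^sub>2\<^esub>"
        using k2 g dvd_trans[OF _ dvd_lcm2] by (auto simp: \<psi>\<^sub>2.H.pow_eq_id)
      ultimately show "g [^]\<^bsub>G\<^esub> lcm k\<^sub>1 k\<^sub>2 = \<one>\<^bsub>G\<^esub>" by (rule pow)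
      show "[f g = 1] (mod int (lcm k\<^sub>1 k\<^sub>2))"
        using cong_trans[OF f(1)[OF gK] f1(2)] cong_trans[OF f(2)[OF gK] f2(2)] by (rule lcm)
      fix x y assume xy: "x \<in> ?K" "y \<in> ?K"
      have xyK: "x \<otimes>\<^bsub>G\<^esub> y \<in> ?K" using K(1) xy by (rule subgroup.m_closed)
      have "[f (x \<otimes>\<^bsub>G\<^esub> y) = f x + f y] (mod int k\<^sub>1)"
      proof -
        note f(1)[OF xyK]
        also have "[f\<^sub>1 (\<psi>\<^sub>1 (x \<otimes>\<^bsub>G\<^esub> y)) = f\<^sub>1 (\<psi>\<^sub>1 x) + f\<^sub>1 (\<psi>\<^sub>1 y)] (mod int k\<^sub>1)"
          using f1(1)[of "\<psi>\<^sub>1 x" "\<psi>\<^sub>1 y"] xy by simp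
        also have "[f\<^sub>1 (\<psi>\<^sub>1 x) + f\<^sub>1 (\<psi>\<^sub>1 y) = f x + f y] (mod int k\<^sub>1)"
          using cong_add[OF f(1)[OF xy(1)] f(1)[OF xy(2)]] by (rule cong_sym)
        finally show ?thesis .
      qed
      moreover have "[f (x \<otimes>\<^bsub>G\<^esub> y) = f x + f y] (mod int k\<^sub>2)"
      proof -
        note f(2)[OF xyK]
        also have "[f\<^sub>2 (\<psi>\<^sub>2 (x \<otimes>\<^bsub>G\<^esub> y)) = f\<^sub>2 (\<psi>\<^sub>2 x) + f\<^sub>2 (\<psi>\<^sub>2 y)] (mod int k\<^sub>2)"
          using f2(1)[of "\<psi>\<^sub>2 x" "\<psi>\<^sub>2 y"] xy by simp
        also have "[f\<^sub>2 (\<psi>\<^sub>2 x) + f\<^sub>2 (\<psi>\<^sub>2 y) = f x + f y] (mod int k\<^sub>2)"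
          using cong_add[OF f(2)[OF xy(1)] f(2)[OF xy(2)]] by (rule cong_sym)
        finally show ?thesis .
      qed
      ultimately show "[f (x \<otimes>\<^bsub>G\<^esub> y) = f x + f y] (mod int (lcm k\<^sub>1 k\<^sub>2))" by (rule lcm)
    qed
  qed
qed

section \<open>Retractions from translation lengths\<close>

text \<open>The subgroup is the stabiliser of the \<open>T\<close>-orbit of \<open>w\<close> and the
  exponent of \<open>x\<close> is the distance by which it translates \<open>w\<close>, unique by
  freeness. The index is finite because the orbit of \<open>w\<close> meets only finitely many
  \<open>T\<close>-orbits.\<close>

lemma (in group) cyclic_virtual_retract_action:
  fixes \<Phi> :: "'a \<Rightarrow> 'w \<Rightarrow> 'w" and T :: "int \<Rightarrow> 'w \<Rightarrow> 'w"
  assumes g: "g \<in> carrier G" "\<Phi> g w = T 1 w"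
    and \<Phi>_one: "\<And>u. \<Phi> \<one> u = u"
    and \<Phi>_mult: "\<And>x y u. x \<in> carrier G \<Longrightarrow> y \<in> carrier G \<Longrightarrow> \<Phi> (x \<otimes> y) u = \<Phi> x (\<Phi> y u)"
    and T_zero: "\<And>u. T 0 u = u"
    and T_add: "\<And>a b u. T (a + b) u = T a (T b u)"
    and comm: "\<And>x z u. x \<in> carrier G \<Longrightarrow> \<Phi> x (T z u) = T z (\<Phi> x u)"
    and free: "\<And>z. T z w = w \<Longrightarrow> z = 0"
    and X: "finite X" "\<And>x. x \<in> carrier G \<Longrightarrow> \<exists>z. \<exists>p\<in>X. \<Phi> x w = T z p"
  shows "cyclic_virtual_retract G g"
proof -
  let ?K = "{x \<in> carrier G. \<exists>z. \<Phi> x w = T z w}"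
  define f where "f x = (SOME z. \<Phi> x w = T z w)" for x
  have f: "\<Phi> x w = T (f x) w" if "x \<in> ?K" for x
    using that unfolding f_def by (auto intro: someI_ex)
  have free': "a = b" if "T a w = T b w" for a b
    using free[of "a - b"] T_add[of "-b" a w] T_add[of "-b" b w] that T_zero by simp
  have inv: "\<Phi> (inv x) w = T (-z) u" if "x \<in> carrier G" "\<Phi> x u = T z w" for x z u
  proof -
    have "\<Phi> (inv x) (\<Phi> x u) = u"
      using \<Phi>_mult[of "inv x" x u] \<Phi>_one that by simp
    then have "T z (\<Phi> (inv x) w) = u" using comm that by simp
    then have "T (-z + z) (\<Phi> (inv x) w) = T (-z) u" by (simp only: T_add)
    then show ?thesis by (simp add: T_zero)
  qed
  have sub: "subgroup ?K G"
  proof (rule subgroupI)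
    show "?K \<noteq> {}" using \<Phi>_one T_zero by (auto intro!: exI[of _ \<one>] exI[of _ 0])
    show "inv x \<in> ?K" if "x \<in> ?K" for x using that inv[of x w] by auto
    show "x \<otimes> y \<in> ?K" if "x \<in> ?K" "y \<in> ?K" for x y
      using that by (auto simp: \<Phi>_mult comm simp flip: T_add)
  qed auto
  \<comment> \<open>Right cosets of the stabiliser are told apart by the \<open>T\<close>-orbit of
    the image of \<open>w\<close> under \<open>inv x\<close>, not under \<open>x\<close>.\<close>
  have "\<exists>p. \<forall>x\<in>carrier G. p x \<in> X \<and> (\<exists>z. \<Phi> (inv x) w = T z (p x))"
    using X(2) by (intro bchoice) (meson inv_closed)
  then obtain p where p: "\<And>x. x \<in> carrier G \<Longrightarrow> p x \<in> X"
    "\<And>x. x \<in> carrier G \<Longrightarrow> \<exists>z. \<Phi> (inv x) w = T z (p x)" by blast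
  have fin: "finite (rcosets ?K)"
  proof (rule finite_rcosetsI[OF sub X(1), where c = p])
    fix x y assume x: "x \<in> carrier G" and y: "y \<in> carrier G" and "p x = p y"
    then obtain a b where a: "\<Phi> (inv x) w = T a (p x)" and b: "\<Phi> (inv y) w = T b (p x)"
      using p(2) by metis
    have "\<Phi> (inv y) w = T (b - a) (\<Phi> (inv x) w)" using a b T_add[of "b - a" a] by simp
    then have "\<Phi> (x \<otimes> inv y) w = T (b - a) (\<Phi> x (\<Phi> (inv x) w))"
      using x y by (simp add: \<Phi>_mult comm)
    also have "\<Phi> x (\<Phi> (inv x) w) = w" using \<Phi>_mult[of x "inv x" w] \<Phi>_one x by simp
    finally show "x \<otimes> inv y \<in> ?K" using x y by auto
  qed (rule p(1))
  show ?thesis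
    unfolding cyclic_virtual_retract_def
  proof (intro exI conjI ballI)
    show gK: "g \<in> ?K" using g by auto
    show "g [^] (0::nat) = \<one>" by simp
    show "[f g = 1] (mod int 0)" using free'[of "f g" 1] f[OF gK] g(2) by simp
    fix x y assume x: "x \<in> ?K" and y: "y \<in> ?K"
    then have "x \<otimes> y \<in> ?K" by (rule subgroup.m_closed[OF sub])
    then have "T (f (x \<otimes> y)) w = \<Phi> (x \<otimes> y) w" by (rule f[symmetric])
    also have "\<dots> = T (f y) (\<Phi> x w)" using x y f[OF y] by (simp add: \<Phi>_mult comm)
    also have "\<dots> = T (f x + f y) w" using f[OF x] by (simp add: add.commute[of "f x"] T_add)
    finally show "[f (x \<otimes> y) = f x + f y] (mod int 0)" using free'[of "f (x \<otimes> y)" "f x + f y"] by simp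
  qed (rule sub fin)+
qed

section \<open>Graph products by generators and relations\<close>

definition gp_incl ::
    "'v pair_pre_digraph \<Rightarrow> ('v \<Rightarrow> ('a, 'b) monoid_scheme) \<Rightarrow> 'v \<Rightarrow> 'a \<Rightarrow> ('v \<times> 'a) list set set" where
  "gp_incl \<Gamma> G v g =
     normal_closure (free_product (pverts \<Gamma>) G) (graph_product_relators \<Gamma> G)
       #>\<^bsub>free_product (pverts \<Gamma>) G\<^esub> fp_incl (pverts \<Gamma>) G v g"

locale graph_of_groups = pair_graph \<Gamma> for \<Gamma> :: "'v pair_pre_digraph" +
  fixes G :: "'v \<Rightarrow> ('a, 'b) monoid_scheme"
  assumes group_vertex: "v \<in> pverts \<Gamma> \<Longrightarrow> group (G v)"
begin

abbreviation "FP \<equiv> free_product (pverts \<Gamma>) G"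
abbreviation "GP \<equiv> graph_product \<Gamma> G"
abbreviation "\<iota> \<equiv> gp_incl \<Gamma> G"
abbreviation "rels \<equiv> graph_product_relators \<Gamma> G"

lemma group_FP: "group FP"
  by (rule group_free_product[of _ G, OF group_vertex])

lemma group_GP: "group GP"
  by (rule group_graph_product) (use pair_graph_axioms group_vertex in auto)

lemma fp_incl_closed:
  "v \<in> pverts \<Gamma> \<Longrightarrow> g \<in> carrier (G v) \<Longrightarrow> fp_incl (pverts \<Gamma>) G v g \<in> carrier FP"
  by (rule hom_in_carrier[OF fp_incl_hom[of _ G, OF group_vertex]])

lemma relators_subset: "rels \<subseteq> carrier FP"
proof -
  interpret F: group FP by (rule group_FP)
  show ?thesis
    by (auto simp: graph_product_relators_def commutator_def in_arcsD1 in_arcsD2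
        intro!: F.m_closed F.inv_closed fp_incl_closed)
qed

lemma normal_relators: "normal_closure FP rels \<lhd> FP"
  using group_FP relators_subset by (rule normal_normal_closure)

lemma gp_incl_hom: "v \<in> pverts \<Gamma> \<Longrightarrow> \<iota> v \<in> hom (G v) GP"
  using hom_compose[OF fp_incl_hom[of _ G, OF group_vertex] normal.r_coset_hom_Mod[OF normal_relators]]
  by (simp add: gp_incl_def[abs_def] graph_product_def comp_def)

lemma gp_incl_closed [simp]: "v \<in> pverts \<Gamma> \<Longrightarrow> g \<in> carrier (G v) \<Longrightarrow> \<iota> v g \<in> carrier GP"
  by (rule hom_in_carrier[OF gp_incl_hom])

lemma gp_incl_one [simp]: "v \<in> pverts \<Gamma> \<Longrightarrow> \<iota> v \<one>\<^bsub>G v\<^esub> = \<one>\<^bsub>GP\<^esub>"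
  using hom_one[OF gp_incl_hom] group_vertex group_GP by blast

lemma gp_incl_commute:
  assumes uv: "(u, v) \<in> parcs \<Gamma>" and g: "g \<in> carrier (G u)" and h: "h \<in> carrier (G v)"
  shows "\<iota> u g \<otimes>\<^bsub>GP\<^esub> \<iota> v h = \<iota> v h \<otimes>\<^bsub>GP\<^esub> \<iota> u g"
proof -
  interpret F: group FP by (rule group_FP)
  interpret N: normal "normal_closure FP rels" FP by (rule normal_relators)
  let ?a = "fp_incl (pverts \<Gamma>) G u g" and ?b = "fp_incl (pverts \<Gamma>) G v h"
  have ab: "?a \<in> carrier FP" "?b \<in> carrier FP"
    using assms by (auto intro: fp_incl_closed in_arcsD1 in_arcsD2)
  have "commutator FP ?a ?b \<in> rels"
    using assms by (auto simp: graph_product_relators_def)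
  then have "commutator FP ?a ?b \<in> normal_closure FP rels"
    by (auto simp: normal_closure_def)
  moreover have "commutator FP ?a ?b = (?a \<otimes>\<^bsub>FP\<^esub> ?b) \<otimes>\<^bsub>FP\<^esub> inv\<^bsub>FP\<^esub> (?b \<otimes>\<^bsub>FP\<^esub> ?a)"
    using ab by (simp add: commutator_def F.inv_mult_group F.m_assoc)
  ultimately have "normal_closure FP rels #>\<^bsub>FP\<^esub> (?a \<otimes>\<^bsub>FP\<^esub> ?b) = normal_closure FP rels #>\<^bsub>FP\<^esub> (?b \<otimes>\<^bsub>FP\<^esub> ?a)"
    using F.rcos_eq_iff[OF N.is_subgroup] ab by simp
  then show ?thesis
    using ab by (simp add: gp_incl_def graph_product_def N.rcos_sum)
qed

text \<open>Every element is the image of a word, and prefixing a letter is left multiplication by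
  an element of a vertex group.\<close>

lemma gp_induct [consumes 1, case_names one mult]:
  assumes "x \<in> carrier GP" and one: "P \<one>\<^bsub>GP\<^esub>"
    and mult: "\<And>v g x. v \<in> pverts \<Gamma> \<Longrightarrow> g \<in> carrier (G v) \<Longrightarrow> x \<in> carrier GP \<Longrightarrow> P x \<Longrightarrow>
      P (\<iota> v g \<otimes>\<^bsub>GP\<^esub> x)"
  shows "P x"
proof -
  interpret F: group FP by (rule group_FP)
  interpret N: normal "normal_closure FP rels" FP by (rule normal_relators)
  let ?q = "\<lambda>w. normal_closure FP rels #>\<^bsub>FP\<^esub> (fp_cong (pverts \<Gamma>) G `` {w})"
  have "P (?q w) \<and> ?q w \<in> carrier GP" if "w \<in> fp_words (pverts \<Gamma>) G" for w
    using that
  proof (induction w)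
    case Nil
    have "?q [] = \<one>\<^bsub>GP\<^esub>"
      using F.coset_mult_one[OF N.subset] by (simp add: graph_product_def free_product_def)
    then show ?case using one group.is_monoid[OF group_GP] by (simp add: monoid.one_closed)
  next
    case (Cons a w)
    obtain v g where a: "a = (v, g)" by (cases a)
    with Cons.prems have v: "v \<in> pverts \<Gamma>" "g \<in> carrier (G v)" "w \<in> fp_words (pverts \<Gamma>) G" by auto
    have "fp_cong (pverts \<Gamma>) G `` {a # w} =
        fp_incl (pverts \<Gamma>) G v g \<otimes>\<^bsub>FP\<^esub> fp_cong (pverts \<Gamma>) G `` {w}"
      using fp_mult_class[of "pverts \<Gamma>" G "[a]" w, OF group_vertex] v a by (simp add: fp_incl_def)
    then have "?q (a # w) = \<iota> v g \<otimes>\<^bsub>GP\<^esub> ?q w"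
      using v fp_incl_closed[OF v(1,2)] fp_class_in_carrier[OF v(3)]
      by (simp add: gp_incl_def graph_product_def N.rcos_sum)
    then show ?case
      using mult[OF v(1,2)] Cons.IH[OF v(3)] gp_incl_closed[OF v(1,2)] group.is_monoid[OF group_GP]
      by (simp add: monoid.m_closed)
  qed
  moreover obtain w where "w \<in> fp_words (pverts \<Gamma>) G" "x = ?q w"
    using assms(1) by (auto simp: graph_product_def carrier_FactGroup elim!: fp_carrierE)
  ultimately show ?thesis by simp
qed

text \<open>Evaluating words in \<open>H\<close> respects the free product congruence, and commuting
  images send every relator to the identity. The evaluation thus descends to the quotient.\<close>

lemma gp_universal:
  assumes "group H" and \<phi>: "\<And>v. v \<in> pverts \<Gamma> \<Longrightarrow> \<phi> v \<in> hom (G v) H"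
    and comm: "\<And>u v g h. (u, v) \<in> parcs \<Gamma> \<Longrightarrow> g \<in> carrier (G u) \<Longrightarrow> h \<in> carrier (G v) \<Longrightarrow>
      \<phi> u g \<otimes>\<^bsub>H\<^esub> \<phi> v h = \<phi> v h \<otimes>\<^bsub>H\<^esub> \<phi> u g"
  obtains \<Phi> where "\<Phi> \<in> hom GP H"
    "\<And>v g. v \<in> pverts \<Gamma> \<Longrightarrow> g \<in> carrier (G v) \<Longrightarrow> \<Phi> (\<iota> v g) = \<phi> v g"
proof -
  interpret F: group FP by (rule group_FP)
  interpret N: normal "normal_closure FP rels" FP by (rule normal_relators)
  interpret H: group H by fact
  define ev where "ev w = foldr (\<lambda>(v, g) r. \<phi> v g \<otimes>\<^bsub>H\<^esub> r) w \<one>\<^bsub>H\<^esub>" for w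
  have [simp]: "\<phi> v g \<in> carrier H" if "v \<in> pverts \<Gamma>" "g \<in> carrier (G v)" for v g
    using hom_in_carrier[OF \<phi>] that by blast
  have ev_Nil [simp]: "ev [] = \<one>\<^bsub>H\<^esub>" and ev_Cons [simp]: "ev ((v, g) # w) = \<phi> v g \<otimes>\<^bsub>H\<^esub> ev w" for v g w
    by (simp_all add: ev_def)
  have ev_closed [simp]: "ev w \<in> carrier H" if "w \<in> fp_words (pverts \<Gamma>) G" for w
    using that by (induction w) auto
  have ev_append: "ev (w @ w') = ev w \<otimes>\<^bsub>H\<^esub> ev w'"
    if "w \<in> fp_words (pverts \<Gamma>) G" "w' \<in> fp_words (pverts \<Gamma>) G" for w w'
    using that by (induction w) (auto simp: H.m_assoc)
  have ev_cong: "ev x = ev y" if "(x, y) \<in> fp_cong (pverts \<Gamma>) G" for x y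
    using that
  proof (induction rule: fp_cong.induct)
    case (one x y v)
    then interpret Gv: group "G v" using group_vertex by simp
    have "\<phi> v \<one>\<^bsub>G v\<^esub> = \<one>\<^bsub>H\<^esub>" using hom_one[OF \<phi> Gv.is_group H.is_group] one by simp
    then show ?case using one by (simp add: ev_append)
  next
    case (mult x y v g h)
    then interpret Gv: group "G v" using group_vertex by simp
    show ?case using mult by (simp add: ev_append hom_mult[OF \<phi>] H.m_assoc)
  qed auto
  \<comment> \<open>By \<open>ev_cong\<close> the value does not depend on the representative picked
    from the class.\<close>
  define \<psi> where "\<psi> X = ev (SOME w. w \<in> X)" for X
  have eq: "equiv (fp_words (pverts \<Gamma>) G) (fp_cong (pverts \<Gamma>) G)"
    by (rule equiv_fp_cong[of _ G, OF group_vertex])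
  have \<psi>: "\<psi> (fp_cong (pverts \<Gamma>) G `` {w}) = ev w" if "w \<in> fp_words (pverts \<Gamma>) G" for w
  proof -
    have "(SOME w'. w' \<in> fp_cong (pverts \<Gamma>) G `` {w}) \<in> fp_cong (pverts \<Gamma>) G `` {w}"
      using equiv_class_self[OF eq that] by (rule someI)
    then show ?thesis using ev_cong unfolding \<psi>_def by (metis Image_singleton_iff)
  qed
  have \<psi>_hom: "\<psi> \<in> hom FP H"
    by (rule homI) (auto elim!: fp_carrierE simp: \<psi> fp_mult_class[of _ G, OF group_vertex] ev_append)
  then interpret \<psi>: group_hom FP H \<psi>
    by (simp add: group_hom_def group_hom_axioms_def)
  have \<psi>_incl: "\<psi> (fp_incl (pverts \<Gamma>) G v g) = \<phi> v g" if "v \<in> pverts \<Gamma>" "g \<in> carrier (G v)" for v g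
    using that by (simp add: fp_incl_def \<psi>)
  have "rels \<subseteq> kernel FP H \<psi>"
  proof
    fix r assume "r \<in> rels"
    then obtain u v g h where uv: "(u, v) \<in> parcs \<Gamma>" "g \<in> carrier (G u)" "h \<in> carrier (G v)"
      and r: "r = commutator FP (fp_incl (pverts \<Gamma>) G u g) (fp_incl (pverts \<Gamma>) G v h)"
      by (auto simp: graph_product_relators_def)
    have V: "u \<in> pverts \<Gamma>" "v \<in> pverts \<Gamma>" using uv in_arcsD1 in_arcsD2 by auto
    have "\<psi> r = \<phi> u g \<otimes>\<^bsub>H\<^esub> \<phi> v h \<otimes>\<^bsub>H\<^esub> inv\<^bsub>H\<^esub> (\<phi> v h \<otimes>\<^bsub>H\<^esub> \<phi> u g)"
      using uv V by (simp add: r commutator_def \<psi>_incl fp_incl_closed H.inv_mult_group H.m_assoc)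
    also have "\<dots> = \<one>\<^bsub>H\<^esub>" using V uv by (simp add: comm[OF uv])
    finally show "r \<in> kernel FP H \<psi>"
      using relators_subset \<open>r \<in> rels\<close> by (auto simp: kernel_def)
  qed
  then have ker: "normal_closure FP rels \<subseteq> kernel FP H \<psi>"
    using \<psi>.normal_kernel by (auto simp: normal_closure_def)
  have "\<psi> x = \<psi> y" if "x \<in> carrier FP" "y \<in> carrier FP"
    "normal_closure FP rels #>\<^bsub>FP\<^esub> x = normal_closure FP rels #>\<^bsub>FP\<^esub> y" for x y
  proof -
    have "x \<otimes>\<^bsub>FP\<^esub> inv\<^bsub>FP\<^esub> y \<in> kernel FP H \<psi>"
      using F.rcos_eq_iff[OF N.is_subgroup] that ker by blast
    then have "\<psi> x \<otimes>\<^bsub>H\<^esub> inv\<^bsub>H\<^esub> \<psi> y = \<one>\<^bsub>H\<^esub>"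
      using that by (simp add: kernel_def)
    then show ?thesis using that H.inv_equality[of "\<psi> x" "inv\<^bsub>H\<^esub> \<psi> y"] by simp
  qed
  then obtain \<Phi> where \<Phi>: "\<Phi> \<in> hom (FP Mod normal_closure FP rels) H"
    "\<And>x. x \<in> carrier FP \<Longrightarrow> \<Phi> (normal_closure FP rels #>\<^bsub>FP\<^esub> x) = \<psi> x"
    using FactGroup_universal[OF \<psi>_hom normal_relators] by metis
  show thesis
    by (rule that[of \<Phi>]) (use \<Phi> in \<open>simp_all add: graph_product_def gp_incl_def fp_incl_closed \<psi>_incl\<close>)
qed

lemma gp_hom_eqI:
  assumes "group H" "\<Phi> \<in> hom GP H" "\<Psi> \<in> hom GP H" "x \<in> carrier GP"
    and "\<And>v g. v \<in> pverts \<Gamma> \<Longrightarrow> g \<in> carrier (G v) \<Longrightarrow> \<Phi> (\<iota> v g) = \<Psi> (\<iota> v g)"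
  shows "\<Phi> x = \<Psi> x"
  using assms(4)
proof (induction rule: gp_induct)
  case one
  show ?case using hom_one[OF assms(2)] hom_one[OF assms(3)] group_GP assms(1) by simp
next
  case (mult v g x)
  then show ?case using assms(5) hom_mult[OF assms(2)] hom_mult[OF assms(3)] by simp
qed

end

definition delete_vertex :: "'v \<Rightarrow> 'v pair_pre_digraph \<Rightarrow> 'v pair_pre_digraph" where
  "delete_vertex v \<Gamma> =
     \<lparr>pverts = pverts \<Gamma> - {v}, parcs = parcs \<Gamma> \<inter> (pverts \<Gamma> - {v}) \<times> (pverts \<Gamma> - {v})\<rparr>"

lemma delete_vertex_simps [simp]:
  "pverts (delete_vertex v \<Gamma>) = pverts \<Gamma> - {v}"
  "parcs (delete_vertex v \<Gamma>) = parcs \<Gamma> \<inter> (pverts \<Gamma> - {v}) \<times> (pverts \<Gamma> - {v})"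
  by (simp_all add: delete_vertex_def)

lemma (in graph_of_groups) graph_of_groups_delete_vertex:
  "graph_of_groups (delete_vertex v \<Gamma>) G"
proof -
  have "sym (parcs \<Gamma>)" using pair_sym_arcs by (simp add: symmetric_def)
  then have "pair_graph (delete_vertex v \<Gamma>)"
    by unfold_locales
      (auto simp: pair_finite_verts symmetric_def with_proj_simps pair_finite_arcs dest: pair_no_loops symD intro!: symI)
  then show ?thesis
    by (simp add: graph_of_groups_def graph_of_groups_axioms_def group_vertex)
qed

section \<open>Permutations\<close>

text \<open>Permutations of a whole type spare the action a carrier condition; the maps below
  therefore also treat tuples with coordinates outside the group carriers.\<close>

definition bij_group :: "('w \<Rightarrow> 'w) monoid" where
  "bij_group = \<lparr>carrier = {f. bij f}, monoid.mult = (\<circ>), one = id\<rparr>"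

lemma bij_group_simps [simp]:
  "carrier bij_group = {f. bij f}" "f \<otimes>\<^bsub>bij_group\<^esub> g = f \<circ> g" "\<one>\<^bsub>bij_group\<^esub> = id"
  by (simp_all add: bij_group_def)

lemma group_bij_group: "group bij_group"
proof (rule groupI)
  fix f :: "'a \<Rightarrow> 'a" assume "f \<in> carrier bij_group"
  then show "\<exists>g\<in>carrier bij_group. g \<otimes>\<^bsub>bij_group\<^esub> f = \<one>\<^bsub>bij_group\<^esub>"
    by (intro bexI[of _ "inv_into UNIV f"]) (simp_all add: bij_imp_bij_inv bij_is_inj)
qed (auto intro: bij_comp)

text \<open>Bijectivity comes for free: the map of \<open>inv x\<close> is a two-sided inverse of
  the map of \<open>x\<close>.\<close>

lemma (in group) hom_bij_groupI:
  assumes "\<phi> \<one> = id" "\<And>x y. x \<in> carrier G \<Longrightarrow> y \<in> carrier G \<Longrightarrow> \<phi> (x \<otimes> y) = \<phi> x \<circ> \<phi> y"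
  shows "\<phi> \<in> hom G bij_group"
proof (rule homI)
  fix x assume "x \<in> carrier G"
  then show "\<phi> x \<in> carrier bij_group"
    using assms(2)[of x "inv x"] assms(2)[of "inv x" x] assms(1)
    by (auto intro: o_bij[of "\<phi> (inv x)"])
qed (simp add: assms)

section \<open>An action on a line of blocks\<close>

text \<open>
  Each position \<open>i\<close> carries a copy of \<open>F \<times> H\<close>. On the right cosets of \<open>M\<close> other than that of \<open>x i\<close>
  the group \<open>F\<close> acts trivially at position \<open>i\<close>; on the coset of \<open>x i\<close> it acts by left
  multiplication, conjugated by the involution \<open>swap\<close> gluing \<open>(i, s i)\<close> to \<open>(i + 1, 1)\<close>. Hence
  \<open>s i\<close> moves position \<open>i\<close> to \<open>i + 1\<close> along the coset of \<open>x i\<close>. Consecutive cosets being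
  distinct is what makes the two gluings at \<open>i\<close> compatible.
\<close>

locale line_action = H: group H + F: group F + M: subgroup M H
  for H :: "('h, 'c) monoid_scheme" and F :: "('f, 'd) monoid_scheme" and M :: "'h set" +
  fixes x :: "int \<Rightarrow> 'h" and s :: "int \<Rightarrow> 'f" and b :: 'h and n :: int
  assumes x_closed [simp]: "x i \<in> carrier H" and s_closed [simp]: "s i \<in> carrier F"
    and b_closed [simp]: "b \<in> carrier H"
    and s_ne: "s i \<noteq> \<one>\<^bsub>F\<^esub>" and x_step: "x (i + 1) \<otimes>\<^bsub>H\<^esub> inv\<^bsub>H\<^esub> x i \<notin> M"
    and x_period: "x (i + z * n) = x i \<otimes>\<^bsub>H\<^esub> b [^]\<^bsub>H\<^esub> z" and s_period: "s (i + z * n) = s i"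
    and n_pos: "n > 0"
begin

definition on_line :: "int \<Rightarrow> 'h \<Rightarrow> bool" where
  "on_line i y \<longleftrightarrow> y \<in> carrier H \<and> y \<otimes>\<^bsub>H\<^esub> inv\<^bsub>H\<^esub> x i \<in> M"

fun swap :: "int \<times> 'f \<times> 'h \<Rightarrow> int \<times> 'f \<times> 'h" where
  "swap (i, f, y) =
     (if f = s i \<and> on_line i y then (i + 1, \<one>\<^bsub>F\<^esub>, y)
      else if f = \<one>\<^bsub>F\<^esub> \<and> on_line (i - 1) y then (i - 1, s (i - 1), y)
      else (i, f, y))"

fun mult_line :: "'f \<Rightarrow> int \<times> 'f \<times> 'h \<Rightarrow> int \<times> 'f \<times> 'h" where
  "mult_line t (i, f, y) = (i, if on_line i y \<and> f \<in> carrier F then t \<otimes>\<^bsub>F\<^esub> f else f, y)"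

definition act_F :: "'f \<Rightarrow> int \<times> 'f \<times> 'h \<Rightarrow> int \<times> 'f \<times> 'h" where
  "act_F t = swap \<circ> mult_line t \<circ> swap"

fun act_H :: "'h \<Rightarrow> int \<times> 'f \<times> 'h \<Rightarrow> int \<times> 'f \<times> 'h" where
  "act_H h (i, f, y) = (i, f, if y \<in> carrier H then h \<otimes>\<^bsub>H\<^esub> y else y)"

text \<open>Right multiplication by powers of \<open>b\<close> commutes with the left multiplication
  in \<open>act_H\<close> and follows the periodicity of \<open>x\<close>.\<close>

fun shift :: "int \<Rightarrow> int \<times> 'f \<times> 'h \<Rightarrow> int \<times> 'f \<times> 'h" where
  "shift z (i, f, y) = (i + z * n, f, if y \<in> carrier H then y \<otimes>\<^bsub>H\<^esub> b [^]\<^bsub>H\<^esub> z else y)"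

abbreviation "points \<equiv> UNIV \<times> carrier F \<times> carrier H"

lemma on_line_x: "on_line i (x i)" "\<not> on_line (i - 1) (x i)"
  using x_step[of "i - 1"] by (auto simp: on_line_def)

text \<open>Left multiplication by elements of \<open>M\<close> preserves right cosets of
  \<open>M\<close>. This is why \<open>M\<close> commutes with the action of
  \<open>F\<close>.\<close>

lemma on_line_M:
  assumes "m \<in> M"
  shows "on_line i (if y \<in> carrier H then m \<otimes>\<^bsub>H\<^esub> y else y) = on_line i y"
proof (cases "y \<in> carrier H")
  case True
  have "m \<otimes>\<^bsub>H\<^esub> y \<otimes>\<^bsub>H\<^esub> inv\<^bsub>H\<^esub> x i = m \<otimes>\<^bsub>H\<^esub> (y \<otimes>\<^bsub>H\<^esub> inv\<^bsub>H\<^esub> x i)"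
    and "inv\<^bsub>H\<^esub> m \<otimes>\<^bsub>H\<^esub> (m \<otimes>\<^bsub>H\<^esub> (y \<otimes>\<^bsub>H\<^esub> inv\<^bsub>H\<^esub> x i)) = y \<otimes>\<^bsub>H\<^esub> inv\<^bsub>H\<^esub> x i"
    using assms True by (simp_all add: H.m_assoc H.inv_cancel)
  then have "m \<otimes>\<^bsub>H\<^esub> y \<otimes>\<^bsub>H\<^esub> inv\<^bsub>H\<^esub> x i \<in> M \<longleftrightarrow> y \<otimes>\<^bsub>H\<^esub> inv\<^bsub>H\<^esub> x i \<in> M"
    using assms by (metis M.m_closed M.m_inv_closed)
  then show ?thesis using assms True by (simp add: on_line_def)
qed simp

lemma on_line_shift:
  "on_line (i + z * n) (if y \<in> carrier H then y \<otimes>\<^bsub>H\<^esub> b [^]\<^bsub>H\<^esub> z else y) = on_line i y"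
proof (cases "y \<in> carrier H")
  case True
  have "y \<otimes>\<^bsub>H\<^esub> b [^]\<^bsub>H\<^esub> z \<otimes>\<^bsub>H\<^esub> inv\<^bsub>H\<^esub> (x i \<otimes>\<^bsub>H\<^esub> b [^]\<^bsub>H\<^esub> z) = y \<otimes>\<^bsub>H\<^esub> inv\<^bsub>H\<^esub> x i"
    using True by (simp add: H.inv_mult_group H.m_assoc H.inv_cancel)
  then show ?thesis using True by (simp add: on_line_def x_period)
qed (simp add: on_line_def)

text \<open>Since \<open>s i\<close> is never the identity, the point reached by one gluing falls
  under exactly the opposite gluing.\<close>

lemma swap_swap: "swap (swap w) = w"
  by (cases w) (auto simp: s_ne s_ne[symmetric])

lemma mult_line_one: "mult_line \<one>\<^bsub>F\<^esub> w = w"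
  by (cases w) auto

lemma mult_line_mult:
  "t \<in> carrier F \<Longrightarrow> u \<in> carrier F \<Longrightarrow> mult_line (t \<otimes>\<^bsub>F\<^esub> u) w = mult_line t (mult_line u w)"
  by (cases w) (auto simp: F.m_assoc)

lemma act_F_hom: "act_F \<in> hom F bij_group"
  by (rule F.hom_bij_groupI) (auto simp: act_F_def fun_eq_iff swap_swap mult_line_one mult_line_mult simp del: swap.simps mult_line.simps)

lemma act_H_hom: "act_H \<in> hom H bij_group"
  by (rule H.hom_bij_groupI) (auto simp: fun_eq_iff H.m_assoc)

lemma swap_act_H: "m \<in> M \<Longrightarrow> swap (act_H m w) = act_H m (swap w)"
  by (cases w) (simp add: on_line_M)

lemma mult_line_act_H: "m \<in> M \<Longrightarrow> mult_line t (act_H m w) = act_H m (mult_line t w)"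
  by (cases w) (simp add: on_line_M)

lemma act_F_act_H: "m \<in> M \<Longrightarrow> act_F t \<circ> act_H m = act_H m \<circ> act_F t"
  by (simp add: act_F_def fun_eq_iff swap_act_H mult_line_act_H del: swap.simps mult_line.simps act_H.simps split_paired_All)

lemma swap_shift: "swap (shift z w) = shift z (swap w)"
proof (cases w)
  case (fields i f y)
  let ?y = "if y \<in> carrier H then y \<otimes>\<^bsub>H\<^esub> b [^]\<^bsub>H\<^esub> z else y"
  have i: "i + z * n - 1 = (i - 1) + z * n" by simp
  have *: "on_line (i + z * n) ?y = on_line i y" "on_line (i + z * n - 1) ?y = on_line (i - 1) y"
    "s (i + z * n) = s i" "s (i + z * n - 1) = s (i - 1)"
    unfolding i by (rule on_line_shift s_period)+
  show ?thesis
    unfolding fields shift.simps swap.simps * by (simp add: algebra_simps)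
qed

lemma mult_line_shift: "mult_line t (shift z w) = shift z (mult_line t w)"
  by (cases w) (simp add: on_line_shift)

lemma act_F_shift: "act_F t (shift z w) = shift z (act_F t w)"
  by (simp add: act_F_def swap_shift mult_line_shift del: swap.simps mult_line.simps shift.simps)

lemma act_H_shift: "h \<in> carrier H \<Longrightarrow> act_H h (shift z w) = shift z (act_H h w)"
  by (cases w) (auto simp: H.m_assoc)

lemma shift_zero: "shift 0 w = w"
  by (cases w) auto

lemma shift_add: "shift (z + z') w = shift z (shift z' w)"
  by (cases w) (auto simp: algebra_simps H.m_assoc simp flip: H.int_pow_mult)

lemma swap_points: "w \<in> points \<Longrightarrow> swap w \<in> points"
  by (cases w) auto

lemma act_F_points: "t \<in> carrier F \<Longrightarrow> w \<in> points \<Longrightarrow> act_F t w \<in> points"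
proof -
  assume t: "t \<in> carrier F" and "w \<in> points"
  then have "mult_line t (swap w) \<in> points"
    using swap_points[of w] by (cases "swap w") auto
  then show ?thesis by (simp add: act_F_def swap_points del: swap.simps)
qed

lemma act_H_points: "h \<in> carrier H \<Longrightarrow> w \<in> points \<Longrightarrow> act_H h w \<in> points"
  by (cases w) auto

text \<open>By \<open>x_step\<close> the first \<open>swap\<close> fixes the point instead of moving
  it back to \<open>i - 1\<close>. Multiplication then reaches \<open>s i\<close>, and the second
  \<open>swap\<close> moves on to \<open>i + 1\<close>.\<close>

lemma act_F_step: "act_F (s i) (i, \<one>\<^bsub>F\<^esub>, x i) = (i + 1, \<one>\<^bsub>F\<^esub>, x i)"
  using on_line_x[of i] s_ne[of i] by (simp add: act_F_def s_ne[symmetric])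

text \<open>Division of the position by \<open>n\<close> gives a fundamental domain, finite as soon
  as \<open>F\<close> and \<open>H\<close> are.\<close>

lemma points_shift:
  assumes "w \<in> points" shows "\<exists>z. \<exists>p \<in> {0..<n} \<times> carrier F \<times> carrier H. w = shift z p"
proof (cases w)
  case (fields i f y)
  have "w = shift (i div n) (i mod n, f, y \<otimes>\<^bsub>H\<^esub> b [^]\<^bsub>H\<^esub> (- (i div n)))"
    using assms by (simp add: fields H.m_assoc flip: H.int_pow_mult)
  moreover have "(i mod n, f, y \<otimes>\<^bsub>H\<^esub> b [^]\<^bsub>H\<^esub> (- (i div n))) \<in> {0..<n} \<times> carrier F \<times> carrier H"
    using assms n_pos by (simp add: fields)
  ultimately show ?thesis by blast
qed

end

section \<open>Splitting off a vertex\<close>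

text \<open>The map \<open>r\<close> is the retraction of \<open>A\<close> onto \<open>L\<close>, regarded as an endomorphism of \<open>A\<close>.\<close>

locale vertex_split = graph_of_groups \<Gamma> G
  for \<Gamma> :: "'v pair_pre_digraph" and G :: "'v \<Rightarrow> ('a, 'b) monoid_scheme" +
  fixes v :: 'v and j p \<rho> r
  assumes v_in: "v \<in> pverts \<Gamma>"
    and j_hom: "j \<in> hom (graph_product (delete_vertex v \<Gamma>) G) GP"
    and j_incl: "\<And>u g. u \<in> pverts \<Gamma> - {v} \<Longrightarrow> g \<in> carrier (G u) \<Longrightarrow>
      j (gp_incl (delete_vertex v \<Gamma>) G u g) = \<iota> u g"
    and p_hom: "p \<in> hom GP (graph_product (delete_vertex v \<Gamma>) G)"
    and p_incl: "\<And>u g. u \<in> pverts \<Gamma> \<Longrightarrow> g \<in> carrier (G u) \<Longrightarrow> p (\<iota> u g) =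
      (if u = v then \<one>\<^bsub>graph_product (delete_vertex v \<Gamma>) G\<^esub> else gp_incl (delete_vertex v \<Gamma>) G u g)"
    and \<rho>_hom: "\<rho> \<in> hom GP (G v)"
    and \<rho>_incl: "\<And>u g. u \<in> pverts \<Gamma> \<Longrightarrow> g \<in> carrier (G u) \<Longrightarrow> \<rho> (\<iota> u g) =
      (if u = v then g else \<one>\<^bsub>G v\<^esub>)"
    and r_hom: "r \<in> hom (graph_product (delete_vertex v \<Gamma>) G) (graph_product (delete_vertex v \<Gamma>) G)"
    and r_incl: "\<And>u g. u \<in> pverts \<Gamma> - {v} \<Longrightarrow> g \<in> carrier (G u) \<Longrightarrow>
      r (gp_incl (delete_vertex v \<Gamma>) G u g) =
      (if (u, v) \<in> parcs \<Gamma> then gp_incl (delete_vertex v \<Gamma>) G u g else \<one>\<^bsub>graph_product (delete_vertex v \<Gamma>) G\<^esub>)"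

text \<open>All four maps come from the universal property, each generator going to its copy or to
  the identity. Since there are no loops, an edge never has \<open>v\<close> at both ends.\<close>

lemma (in graph_of_groups) vertex_split_exists:
  assumes v: "v \<in> pverts \<Gamma>"
  shows "\<exists>j p \<rho> r. vertex_split \<Gamma> G v j p \<rho> r"
proof -
  interpret A: graph_of_groups "delete_vertex v \<Gamma>" G by (rule graph_of_groups_delete_vertex)
  interpret P: group GP by (rule group_GP)
  interpret AP: group A.GP by (rule A.group_GP)
  interpret Gv: group "G v" using v by (rule group_vertex)
  obtain j where j: "j \<in> hom A.GP GP"
    "\<And>u g. u \<in> pverts \<Gamma> - {v} \<Longrightarrow> g \<in> carrier (G u) \<Longrightarrow> j (A.\<iota> u g) = \<iota> u g"
  proof (rule A.gp_universal[OF P.is_group, of \<iota>])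
    show "\<iota> u g \<otimes>\<^bsub>GP\<^esub> \<iota> w h = \<iota> w h \<otimes>\<^bsub>GP\<^esub> \<iota> u g"
      if "(u, w) \<in> parcs (delete_vertex v \<Gamma>)" "g \<in> carrier (G u)" "h \<in> carrier (G w)" for u w g h
      using that by (intro gp_incl_commute) auto
  qed (simp_all add: gp_incl_hom that)
  have triv: "(\<lambda>_. \<one>\<^bsub>H\<^esub>) \<in> hom (G u) H" if "group H" for u and H :: "('c, 'd) monoid_scheme"
  proof -
    interpret H: group H by fact
    show ?thesis by (rule homI) auto
  qed
  obtain p where p: "p \<in> hom GP A.GP" "\<And>u g. u \<in> pverts \<Gamma> \<Longrightarrow> g \<in> carrier (G u) \<Longrightarrow>
      p (\<iota> u g) = (if u = v then \<one>\<^bsub>A.GP\<^esub> else A.\<iota> u g)"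
  proof (rule gp_universal[OF AP.is_group, of "\<lambda>u g. if u = v then \<one>\<^bsub>A.GP\<^esub> else A.\<iota> u g"])
    fix u assume u: "u \<in> pverts \<Gamma>"
    show "(\<lambda>g. if u = v then \<one>\<^bsub>A.GP\<^esub> else A.\<iota> u g) \<in> hom (G u) A.GP"
      using triv[OF AP.is_group] A.gp_incl_hom[of u] u by (cases "u = v") simp_all
  next
    fix u w g h assume uw: "(u, w) \<in> parcs \<Gamma>" "g \<in> carrier (G u)" "h \<in> carrier (G w)"
    then have "u \<in> pverts \<Gamma>" "w \<in> pverts \<Gamma>" by (auto dest: in_arcsD1 in_arcsD2)
    then show "(if u = v then \<one>\<^bsub>A.GP\<^esub> else A.\<iota> u g) \<otimes>\<^bsub>A.GP\<^esub> (if w = v then \<one>\<^bsub>A.GP\<^esub> else A.\<iota> w h) =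
        (if w = v then \<one>\<^bsub>A.GP\<^esub> else A.\<iota> w h) \<otimes>\<^bsub>A.GP\<^esub> (if u = v then \<one>\<^bsub>A.GP\<^esub> else A.\<iota> u g)"
      using uw A.gp_incl_commute[of u w g h] by auto
  qed (rule that)
  obtain \<rho> where \<rho>: "\<rho> \<in> hom GP (G v)" "\<And>u g. u \<in> pverts \<Gamma> \<Longrightarrow> g \<in> carrier (G u) \<Longrightarrow>
      \<rho> (\<iota> u g) = (if u = v then g else \<one>\<^bsub>G v\<^esub>)"
  proof (rule gp_universal[OF Gv.is_group, of "\<lambda>u g. if u = v then g else \<one>\<^bsub>G v\<^esub>"])
    fix u assume "u \<in> pverts \<Gamma>"
    show "(\<lambda>g. if u = v then g else \<one>\<^bsub>G v\<^esub>) \<in> hom (G u) (G v)"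
      using triv[OF Gv.is_group] by (cases "u = v") (simp_all add: hom_def Pi_def)
  next
    fix u w g h assume uw: "(u, w) \<in> parcs \<Gamma>" "g \<in> carrier (G u)" "h \<in> carrier (G w)"
    then show "(if u = v then g else \<one>\<^bsub>G v\<^esub>) \<otimes>\<^bsub>G v\<^esub> (if w = v then h else \<one>\<^bsub>G v\<^esub>) =
        (if w = v then h else \<one>\<^bsub>G v\<^esub>) \<otimes>\<^bsub>G v\<^esub> (if u = v then g else \<one>\<^bsub>G v\<^esub>)"
      using pair_no_loops[OF uw(1)] by auto
  qed (rule that)
  obtain r where r: "r \<in> hom A.GP A.GP" "\<And>u g. u \<in> pverts (delete_vertex v \<Gamma>) \<Longrightarrow> g \<in> carrier (G u) \<Longrightarrow>
      r (A.\<iota> u g) = (if (u, v) \<in> parcs \<Gamma> then A.\<iota> u g else \<one>\<^bsub>A.GP\<^esub>)"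
  proof (rule A.gp_universal[OF AP.is_group, of "\<lambda>u g. if (u, v) \<in> parcs \<Gamma> then A.\<iota> u g else \<one>\<^bsub>A.GP\<^esub>"])
    fix u assume "u \<in> pverts (delete_vertex v \<Gamma>)"
    then show "(\<lambda>g. if (u, v) \<in> parcs \<Gamma> then A.\<iota> u g else \<one>\<^bsub>A.GP\<^esub>) \<in> hom (G u) A.GP"
      using triv[OF AP.is_group] A.gp_incl_hom[of u] by (cases "(u, v) \<in> parcs \<Gamma>") simp_all
  next
    fix u w g h assume uw: "(u, w) \<in> parcs (delete_vertex v \<Gamma>)" "g \<in> carrier (G u)" "h \<in> carrier (G w)"
    then show "(if (u, v) \<in> parcs \<Gamma> then A.\<iota> u g else \<one>\<^bsub>A.GP\<^esub>) \<otimes>\<^bsub>A.GP\<^esub>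
          (if (w, v) \<in> parcs \<Gamma> then A.\<iota> w h else \<one>\<^bsub>A.GP\<^esub>) =
        (if (w, v) \<in> parcs \<Gamma> then A.\<iota> w h else \<one>\<^bsub>A.GP\<^esub>) \<otimes>\<^bsub>A.GP\<^esub>
          (if (u, v) \<in> parcs \<Gamma> then A.\<iota> u g else \<one>\<^bsub>A.GP\<^esub>)"
      using A.gp_incl_commute[of u w g h] by auto
  qed (rule that)
  have "vertex_split \<Gamma> G v j p \<rho> r"
    by unfold_locales (use v j p \<rho> r in auto)
  then show ?thesis by blast
qed

context vertex_split
begin

interpretation A: graph_of_groups "delete_vertex v \<Gamma>" G by (rule graph_of_groups_delete_vertex)
interpretation P: group GP by (rule group_GP)
interpretation AP: group A.GP by (rule A.group_GP)
interpretation Gv: group "G v" using v_in by (rule group_vertex)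
interpretation j: group_hom A.GP GP j by (simp add: group_hom_def group_hom_axioms_def j_hom P.is_group AP.is_group)
interpretation p: group_hom GP A.GP p by (simp add: group_hom_def group_hom_axioms_def p_hom P.is_group AP.is_group)
interpretation \<rho>: group_hom GP "G v" \<rho> by (simp add: group_hom_def group_hom_axioms_def \<rho>_hom P.is_group Gv.is_group)
interpretation r: group_hom A.GP A.GP r by (simp add: group_hom_def group_hom_axioms_def r_hom AP.is_group)

lemma p_j: "a \<in> carrier A.GP \<Longrightarrow> p (j a) = a"
proof (induction a rule: A.gp_induct)
  case (mult u g x)
  then show ?case by (simp add: j_incl p_incl)
qed simp

lemma \<rho>_j: "a \<in> carrier A.GP \<Longrightarrow> \<rho> (j a) = \<one>\<^bsub>G v\<^esub>"
proof (induction a rule: A.gp_induct)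
  case (mult u g x)
  then show ?case by (simp add: j_incl \<rho>_incl)
qed simp

lemma r_r: "a \<in> carrier A.GP \<Longrightarrow> r (r a) = r a"
proof (induction a rule: A.gp_induct)
  case (mult u g x)
  then show ?case by (simp add: r_incl)
qed simp

text \<open>The image of \<open>r\<close> is generated by the vertex groups of the neighbours of
  \<open>v\<close>, and these commute with the group at \<open>v\<close>.\<close>

lemma j_r_commute:
  assumes "a \<in> carrier A.GP" and s: "s \<in> carrier (G v)"
  shows "j (r a) \<otimes>\<^bsub>GP\<^esub> \<iota> v s = \<iota> v s \<otimes>\<^bsub>GP\<^esub> j (r a)"
  using assms(1)
proof (induction a rule: A.gp_induct)
  case one
  then show ?case using s v_in by simp
next
  case (mult u g x)
  show ?case
  proof (cases "(u, v) \<in> parcs \<Gamma>")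
    case True
    have "\<iota> u g \<otimes>\<^bsub>GP\<^esub> j (r x) \<otimes>\<^bsub>GP\<^esub> \<iota> v s = \<iota> u g \<otimes>\<^bsub>GP\<^esub> (\<iota> v s \<otimes>\<^bsub>GP\<^esub> j (r x))"
      using mult s v_in by (simp add: P.m_assoc)
    also have "\<dots> = (\<iota> u g \<otimes>\<^bsub>GP\<^esub> \<iota> v s) \<otimes>\<^bsub>GP\<^esub> j (r x)"
      using mult s v_in by (simp add: P.m_assoc)
    also have "\<dots> = \<iota> v s \<otimes>\<^bsub>GP\<^esub> (\<iota> u g \<otimes>\<^bsub>GP\<^esub> j (r x))"
      using mult s v_in gp_incl_commute[OF True, of g s] by (simp add: P.m_assoc)
    finally show ?thesis using mult True by (simp add: r_incl j_incl)
  qed (use mult in \<open>simp add: r_incl\<close>)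
qed

text \<open>The maps \<open>r \<circ> p\<close> and \<open>\<rho>\<close> recover the two factors.
  As the factors commute, a power of the product is trivial once both coordinate powers are.\<close>

lemma cyclic_virtual_retract_elliptic:
  assumes a: "a \<in> carrier A.GP" "r a = a" "cyclic_virtual_retract A.GP a"
    and s: "s \<in> carrier (G v)" "cyclic_virtual_retract (G v) s"
  shows "cyclic_virtual_retract GP (j a \<otimes>\<^bsub>GP\<^esub> \<iota> v s)"
proof -
  have 1: "(r \<circ> p) (j a \<otimes>\<^bsub>GP\<^esub> \<iota> v s) = a" using a s v_in by (simp add: p_j p_incl)
  have 2: "\<rho> (j a \<otimes>\<^bsub>GP\<^esub> \<iota> v s) = s" using a s v_in by (simp add: \<rho>_j \<rho>_incl)
  show ?thesis
  proof (rule cyclic_virtual_retract_prod[OF P.is_group AP.is_group Gv.is_group, where \<psi>\<^sub>1 = "r \<circ> p" and \<psi>\<^sub>2 = \<rho>])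
    show "r \<circ> p \<in> hom GP A.GP" by (rule hom_compose[OF p_hom r_hom])
    fix n :: nat
    assume "(r \<circ> p) (j a \<otimes>\<^bsub>GP\<^esub> \<iota> v s) [^]\<^bsub>A.GP\<^esub> n = \<one>\<^bsub>A.GP\<^esub>" "\<rho> (j a \<otimes>\<^bsub>GP\<^esub> \<iota> v s) [^]\<^bsub>G v\<^esub> n = \<one>\<^bsub>G v\<^esub>"
    then have "a [^]\<^bsub>A.GP\<^esub> n = \<one>\<^bsub>A.GP\<^esub>" "s [^]\<^bsub>G v\<^esub> n = \<one>\<^bsub>G v\<^esub>" unfolding 1 2 .
    moreover have "(j a \<otimes>\<^bsub>GP\<^esub> \<iota> v s) [^]\<^bsub>GP\<^esub> n = j a [^]\<^bsub>GP\<^esub> n \<otimes>\<^bsub>GP\<^esub> \<iota> v s [^]\<^bsub>GP\<^esub> n"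
      using j_r_commute[OF a(1) s(1)] a s v_in by (intro P.pow_mult_distrib) auto
    moreover have "\<iota> v s [^]\<^bsub>GP\<^esub> n = \<iota> v (s [^]\<^bsub>G v\<^esub> n)"
      using hom_nat_pow[OF gp_incl_hom[OF v_in] s(1) Gv.is_group P.is_group] by simp
    moreover have "j a [^]\<^bsub>GP\<^esub> n = j (a [^]\<^bsub>A.GP\<^esub> n)"
      using j.hom_nat_pow[OF a(1)] by simp
    ultimately show "(j a \<otimes>\<^bsub>GP\<^esub> \<iota> v s) [^]\<^bsub>GP\<^esub> n = \<one>\<^bsub>GP\<^esub>" using v_in by simp
  qed (use a s v_in 1 2 \<rho>_hom in \<open>simp_all del: comp_apply\<close>)
qed

text \<open>The factors appear in reverse order, so that in an action the head of the list acts first.\<close>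

fun ev :: "_ \<Rightarrow> _" where
  "ev [] = \<one>\<^bsub>GP\<^esub>"
| "ev ((a, s) # xs) = ev xs \<otimes>\<^bsub>GP\<^esub> (j a \<otimes>\<^bsub>GP\<^esub> \<iota> v s)"

abbreviation "syllables \<equiv> carrier A.GP \<times> carrier (G v)"

lemma ev_closed [simp]: "set xs \<subseteq> syllables \<Longrightarrow> ev xs \<in> carrier GP"
  using v_in by (induction xs rule: ev.induct) auto

lemma ev_append: "set xs \<subseteq> syllables \<Longrightarrow> set ys \<subseteq> syllables \<Longrightarrow> ev (xs @ ys) = ev ys \<otimes>\<^bsub>GP\<^esub> ev xs"
  using v_in by (induction xs rule: ev.induct) (auto simp: P.m_assoc)

text \<open>Each generator is a syllable with one trivial coordinate.\<close>

lemma ev_surj: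
  assumes "x \<in> carrier GP" shows "\<exists>xs. set xs \<subseteq> syllables \<and> ev xs = x"
  using assms
proof (induction x rule: gp_induct)
  case one
  show ?case by (rule exI[of _ "[]"]) simp
next
  case (mult u g x)
  then obtain xs where xs: "set xs \<subseteq> syllables" "ev xs = x" by blast
  let ?a = "if u = v then (\<one>\<^bsub>A.GP\<^esub>, g) else (A.\<iota> u g, \<one>\<^bsub>G v\<^esub>)"
  have "ev (xs @ [?a]) = \<iota> u g \<otimes>\<^bsub>GP\<^esub> x"
    using xs mult v_in by (subst ev_append) (auto simp: j_incl)
  moreover have "set (xs @ [?a]) \<subseteq> syllables" using xs mult by auto
  ultimately show ?case by blast
qed

lemma cyclic_virtual_retract_rotate:
  assumes "set xs \<subseteq> syllables" "set ys \<subseteq> syllables" "cyclic_virtual_retract GP (ev (xs @ ys))"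
  shows "cyclic_virtual_retract GP (ev (ys @ xs))"
  using assms P.cyclic_virtual_retract_swap[of "ev ys" "ev xs"] by (simp add: ev_append)

section \<open>Words that cannot be shortened\<close>

text \<open>Finite quotients that keep every syllable nondegenerate provide the data of a line
  action with one position per syllable. Reading the word once then moves the base point by one
  period.\<close>

lemma cyclic_virtual_retract_hyperbolic:
  assumes DA: "\<And>a. a \<in> carrier A.GP \<Longrightarrow> cyclic_virtual_retract A.GP a"
    and Dv: "\<And>s. s \<in> carrier (G v) \<Longrightarrow> cyclic_virtual_retract (G v) s"
    and xs: "set xs \<subseteq> syllables" "xs \<noteq> []"
    and good: "\<And>a s. (a, s) \<in> set xs \<Longrightarrow> r a \<noteq> a \<and> s \<noteq> \<one>\<^bsub>G v\<^esub>"
  shows "cyclic_virtual_retract GP (ev xs)"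
proof -
  \<comment> \<open>An element lies in the image of the idempotent \<open>r\<close> exactly when it
    is fixed by \<open>r\<close>, so these quotients witness that the \<open>a\<close> lie outside
    the link subgroup.\<close>
  let ?S = "(\<lambda>a. a \<otimes>\<^bsub>A.GP\<^esub> inv\<^bsub>A.GP\<^esub> r a) ` fst ` set xs"
  have "\<one>\<^bsub>A.GP\<^esub> \<notin> ?S"
  proof
    assume "\<one>\<^bsub>A.GP\<^esub> \<in> ?S"
    then obtain a s where a: "(a, s) \<in> set xs" "a \<otimes>\<^bsub>A.GP\<^esub> inv\<^bsub>A.GP\<^esub> r a = \<one>\<^bsub>A.GP\<^esub>" by auto
    then have "a \<in> carrier A.GP" using xs by auto
    then have "a = r a" using AP.inv_equality[OF a(2)] by simp
    then show False using good[OF a(1)] by simp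
  qed
  moreover have "?S \<subseteq> carrier A.GP" using xs(1) by auto
  ultimately obtain N\<^sub>0 where N0: "N\<^sub>0 \<lhd> A.GP" "finite (rcosets\<^bsub>A.GP\<^esub> N\<^sub>0)" "N\<^sub>0 \<inter> ?S = {}"
    using AP.cyclic_virtual_retracts_separate_finite[OF DA, of ?S] by auto
  \<comment> \<open>Requiring \<open>r x \<in> N\<^sub>0\<close> as well makes separation from the
    identity yield separation from the whole image of \<open>r\<close>.\<close>
  define N where "N = N\<^sub>0 \<inter> {x \<in> carrier A.GP. r x \<in> N\<^sub>0}"
  interpret N0: normal N\<^sub>0 A.GP by fact
  have pre: "{x \<in> carrier A.GP. r x \<in> N\<^sub>0} \<lhd> A.GP"
    using r.subgroup_preimage[OF N0.is_subgroup] N0.inv_op_closed2 by (simp add: AP.normal_inv_iff)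
  have N: "N \<lhd> A.GP" "finite (rcosets\<^bsub>A.GP\<^esub> N)"
    unfolding N_def using AP.normal_Int[OF N0(1) pre]
      AP.finite_rcosets_Int[OF N0.is_subgroup N0(2) r.subgroup_preimage[OF N0.is_subgroup]
        r.finite_rcosets_preimage[OF N0.is_subgroup N0(2)]] by simp_all
  interpret N: normal N A.GP by fact
  have "\<one>\<^bsub>G v\<^esub> \<notin> snd ` set xs" "snd ` set xs \<subseteq> carrier (G v)" using good xs(1) by force+
  then obtain N\<^sub>v where Nv: "N\<^sub>v \<lhd> G v" "finite (rcosets\<^bsub>G v\<^esub> N\<^sub>v)" "N\<^sub>v \<inter> snd ` set xs = {}"
    using Gv.cyclic_virtual_retracts_separate_finite[OF Dv, of "snd ` set xs"] by auto
  interpret Nv: normal N\<^sub>v "G v" by fact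
  define H where "H = A.GP Mod N"
  define F where "F = G v Mod N\<^sub>v"
  define q where "q a = N #>\<^bsub>A.GP\<^esub> a" for a
  define qv where "qv s = N\<^sub>v #>\<^bsub>G v\<^esub> s" for s
  have q_hom: "q \<in> hom A.GP H" and qv_hom: "qv \<in> hom (G v) F"
    using N.r_coset_hom_Mod Nv.r_coset_hom_Mod by (simp_all add: q_def[abs_def] qv_def[abs_def] H_def F_def)
  interpret H: group H unfolding H_def by (rule N.factorgroup_is_group)
  interpret F: group F unfolding F_def by (rule Nv.factorgroup_is_group)
  interpret q: group_hom A.GP H q using q_hom by (simp add: group_hom_def group_hom_axioms_def AP.is_group H.is_group)
  interpret qv: group_hom "G v" F qv using qv_hom by (simp add: group_hom_def group_hom_axioms_def Gv.is_group F.is_group)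
  have fin: "finite (carrier H)" "finite (carrier F)"
    using N(2) Nv(2) by (simp_all add: H_def F_def FactGroup_def)
  \<comment> \<open>This is the image of the link subgroup in the finite quotient
    \<open>H\<close>.\<close>
  define M where "M = q ` r ` carrier A.GP"
  have "subgroup (r ` carrier A.GP) A.GP" by (rule r.img_is_subgroup)
  then have M: "subgroup M H" unfolding M_def by (rule q.subgroup_img_is_subgroup)
  have q_notin_M: "q a \<notin> M" if "(a, s) \<in> set xs" for a s
  proof
    have a: "a \<in> carrier A.GP" using that xs(1) by auto
    assume "q a \<in> M"
    then obtain c where c: "c \<in> carrier A.GP" "q a = q (r c)" by (auto simp: M_def)
    \<comment> \<open>Because \<open>r\<close> fixes \<open>r c\<close>, the contribution of
      \<open>c\<close> cancels from the product of \<open>?t\<close> and the inverse of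
      \<open>r ?t\<close>. What remains is an element of \<open>?S\<close>.\<close>
    let ?t = "a \<otimes>\<^bsub>A.GP\<^esub> inv\<^bsub>A.GP\<^esub> r c"
    have "?t \<in> N" using c a AP.rcos_eq_iff[OF N.is_subgroup, of a "r c"] by (simp add: q_def)
    then have "?t \<in> N\<^sub>0" "r ?t \<in> N\<^sub>0" unfolding N_def by blast+
    then have "?t \<otimes>\<^bsub>A.GP\<^esub> inv\<^bsub>A.GP\<^esub> r ?t \<in> N\<^sub>0"
      by (rule N0.m_closed[OF _ N0.m_inv_closed])
    moreover have "?t \<otimes>\<^bsub>A.GP\<^esub> inv\<^bsub>A.GP\<^esub> r ?t = a \<otimes>\<^bsub>A.GP\<^esub> inv\<^bsub>A.GP\<^esub> r a"
      using a c by (simp add: r_r AP.inv_mult_group AP.m_assoc AP.inv_cancel)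
    moreover have "a \<otimes>\<^bsub>A.GP\<^esub> inv\<^bsub>A.GP\<^esub> r a \<in> ?S" using that by force
    ultimately show False using N0(3) by auto
  qed
  define n where "n = length xs"
  have n: "n > 0" using xs(2) by (simp add: n_def)
  define a where "a i = fst (xs ! i)" for i
  define t where "t i = snd (xs ! i)" for i
  have at: "(a i, t i) \<in> set xs" if "i < n" for i
    using that by (simp add: a_def t_def n_def)
  then have at_closed [simp]: "a i \<in> carrier A.GP" "t i \<in> carrier (G v)" if "i < n" for i
    using that xs(1) by auto
  \<comment> \<open>\<open>Q i\<close> will be the \<open>H\<close>-coordinate of the base point
    after \<open>i\<close> syllables, so the newest factor stands on the left.\<close>
  define Q where "Q = rec_nat \<one>\<^bsub>H\<^esub> (\<lambda>i y. q (a i) \<otimes>\<^bsub>H\<^esub> y)"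
  have Q0 [simp]: "Q 0 = \<one>\<^bsub>H\<^esub>" and Q_Suc: "Q (Suc i) = q (a i) \<otimes>\<^bsub>H\<^esub> Q i" for i
    by (simp_all add: Q_def)
  have Q_closed [simp]: "Q i \<in> carrier H" if "i \<le> n" for i
    using that by (induction i) (simp_all add: Q_Suc)
  let ?m = "\<lambda>i. nat (i mod int n)"
  \<comment> \<open>This extends \<open>Q\<close> to all integers with \<open>Q n\<close> as the
    element of the period.\<close>
  define x where "x i = Q (?m i) \<otimes>\<^bsub>H\<^esub> Q n [^]\<^bsub>H\<^esub> (i div int n)" for i
  define s where "s i = qv (t (?m i))" for i
  have m: "?m i < n" for i using n pos_mod_bound[of "int n" i] by linarith
  have x_Suc: "x (i + 1) = q (a (?m i)) \<otimes>\<^bsub>H\<^esub> x i" for i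
  proof (cases "Suc (?m i) < n")
    case True
    then have lt: "i mod int n + 1 < int n" by linarith
    have i: "i + 1 = int n * (i div int n) + (i mod int n + 1)"
      using mult_div_mod_eq[of "int n" i] by linarith
    have nn: "0 \<le> i mod int n + 1" using n by simp
    have "(i + 1) div int n = i div int n" "(i + 1) mod int n = i mod int n + 1"
      using int_div_pos_eq[OF i nn lt] int_mod_pos_eq[OF i nn lt] .
    then have "x (i + 1) = Q (Suc (?m i)) \<otimes>\<^bsub>H\<^esub> Q n [^]\<^bsub>H\<^esub> (i div int n)"
      using n by (simp add: x_def nat_add_distrib)
    then show ?thesis using m[of i] by (simp add: Q_Suc x_def H.m_assoc less_imp_le)
  next
    case False
    \<comment> \<open>At the end of a block the full product \<open>Q n\<close> is absorbed as one
      more power, and the next block starts from \<open>Q 0\<close>.\<close>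
    then have eq: "Suc (?m i) = n" using m[of i] by simp
    then have "i mod int n = int n - 1" using n pos_mod_sign[of "int n" i] by linarith
    then have "i + 1 = int n * (i div int n + 1)"
      using mult_div_mod_eq[of "int n" i] unfolding distrib_left mult_1_right by linarith
    then have "(i + 1) div int n = i div int n + 1" "(i + 1) mod int n = 0"
      using n by simp_all
    then have "x (i + 1) = Q (Suc (?m i)) \<otimes>\<^bsub>H\<^esub> Q n [^]\<^bsub>H\<^esub> (i div int n)"
      using H.int_pow_mult[of "Q n" 1 "i div int n"] by (simp add: x_def eq add.commute)
    then show ?thesis using m[of i] by (simp add: Q_Suc x_def H.m_assoc less_imp_le)
  qed
  have x_closed: "x i \<in> carrier H" for i using m[of i] by (simp add: x_def)
  interpret L: line_action H F M x s "Q n" "int n"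
  proof (intro line_action.intro line_action_axioms.intro)
    fix i z :: int
    show "x i \<in> carrier H" by (rule x_closed)
    show "s i \<in> carrier F" using m[of i] by (simp add: s_def)
    show "s i \<noteq> \<one>\<^bsub>F\<^esub>"
    proof
      assume "s i = \<one>\<^bsub>F\<^esub>"
      then have "N\<^sub>v #>\<^bsub>G v\<^esub> t (?m i) = N\<^sub>v" by (simp add: s_def qv_def F_def)
      then have "t (?m i) \<in> N\<^sub>v" using Gv.rcos_self[OF _ Nv.is_subgroup, of "t (?m i)"] m[of i] by simp
      then show False using Nv(3) at[OF m] by force
    qed
    have "x (i + 1) \<otimes>\<^bsub>H\<^esub> inv\<^bsub>H\<^esub> x i = q (a (?m i))"
      using m[of i] x_closed by (simp add: x_Suc H.m_assoc)
    then show "x (i + 1) \<otimes>\<^bsub>H\<^esub> inv\<^bsub>H\<^esub> x i \<notin> M" using q_notin_M[OF at[OF m[of i]]] by simp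
    show "x (i + z * int n) = x i \<otimes>\<^bsub>H\<^esub> Q n [^]\<^bsub>H\<^esub> z"
      using n m[of i] by (simp add: x_def H.m_assoc add.commute flip: H.int_pow_mult)
    show "s (i + z * int n) = s i" by (simp add: s_def)
  qed (use M n in \<open>simp_all add: x_def H.is_group F.is_group\<close>)
  have act_q: "L.act_H \<circ> q \<in> hom A.GP bij_group" by (rule hom_compose[OF q_hom L.act_H_hom])
  have act_qv: "L.act_F \<circ> qv \<in> hom (G v) bij_group" by (rule hom_compose[OF qv_hom L.act_F_hom])
  \<comment> \<open>Generators at neighbours of \<open>v\<close> are fixed by \<open>r\<close> and
    hence act through \<open>M\<close>; this is the relation needed to combine the two
    actions.\<close>
  have link: "L.act_F (qv c) \<circ> L.act_H (q (A.\<iota> u g)) = L.act_H (q (A.\<iota> u g)) \<circ> L.act_F (qv c)"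
    if "(u, v) \<in> parcs \<Gamma>" "u \<in> pverts \<Gamma> - {v}" "g \<in> carrier (G u)" for u g c
  proof (rule L.act_F_act_H)
    have "r (A.\<iota> u g) = A.\<iota> u g" using that by (simp add: r_incl)
    then show "q (A.\<iota> u g) \<in> M" unfolding M_def using that by (metis A.gp_incl_closed delete_vertex_simps(1) imageI)
  qed
  obtain \<Phi> where \<Phi>: "\<Phi> \<in> hom GP bij_group" "\<And>u g. u \<in> pverts \<Gamma> \<Longrightarrow> g \<in> carrier (G u) \<Longrightarrow>
      \<Phi> (\<iota> u g) = (if u = v then L.act_F (qv g) else L.act_H (q (A.\<iota> u g)))"
  proof (rule gp_universal[OF group_bij_group, of "\<lambda>u g. if u = v then L.act_F (qv g) else L.act_H (q (A.\<iota> u g))"])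
    fix u assume u: "u \<in> pverts \<Gamma>"
    show "(\<lambda>g. if u = v then L.act_F (qv g) else L.act_H (q (A.\<iota> u g))) \<in> hom (G u) bij_group"
    proof (cases "u = v")
      case True
      then show ?thesis using act_qv by (simp add: comp_def)
    next
      case False
      then show ?thesis using hom_compose[OF A.gp_incl_hom act_q, of u] u by (simp add: comp_def)
    qed
  next
    fix u w g h assume uw: "(u, w) \<in> parcs \<Gamma>" "g \<in> carrier (G u)" "h \<in> carrier (G w)"
    then have V: "u \<in> pverts \<Gamma>" "w \<in> pverts \<Gamma>" by (auto dest: in_arcsD1 in_arcsD2)
    have ne: "u \<noteq> w" using pair_no_loops[OF uw(1)] by simp
    have wu: "(w, u) \<in> parcs \<Gamma>" using uw(1) pair_sym_arcs by (auto simp: symmetric_def dest: symD)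
    consider "u = v" | "w = v" | "u \<noteq> v" "w \<noteq> v" by blast
    then show "(if u = v then L.act_F (qv g) else L.act_H (q (A.\<iota> u g))) \<otimes>\<^bsub>bij_group\<^esub>
          (if w = v then L.act_F (qv h) else L.act_H (q (A.\<iota> w h))) =
        (if w = v then L.act_F (qv h) else L.act_H (q (A.\<iota> w h))) \<otimes>\<^bsub>bij_group\<^esub>
          (if u = v then L.act_F (qv g) else L.act_H (q (A.\<iota> u g)))"
    proof cases
      case 1
      then show ?thesis using link[of w h g] wu ne V uw by simp
    next
      case 2
      then show ?thesis using link[of u g h] uw(1) ne V uw by simp
    next
      case 3
      have "(L.act_H \<circ> q) (A.\<iota> u g \<otimes>\<^bsub>A.GP\<^esub> A.\<iota> w h) = (L.act_H \<circ> q) (A.\<iota> w h \<otimes>\<^bsub>A.GP\<^esub> A.\<iota> u g)"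
        using A.gp_incl_commute[of u w g h] uw V 3 by simp
      then show ?thesis
        using 3 V uw hom_mult[OF act_q, of "A.\<iota> u g" "A.\<iota> w h"] hom_mult[OF act_q, of "A.\<iota> w h" "A.\<iota> u g"] by simp
    qed
  qed (rule that)
  have \<Phi>_one: "\<Phi> \<one>\<^bsub>GP\<^esub> = id" using hom_one[OF \<Phi>(1) P.is_group group_bij_group] by simp
  have \<Phi>_mult: "\<Phi> (y \<otimes>\<^bsub>GP\<^esub> z) = \<Phi> y \<circ> \<Phi> z" if "y \<in> carrier GP" "z \<in> carrier GP" for y z
    using hom_mult[OF \<Phi>(1) that] by simp
  have \<Phi>_j: "\<Phi> (j c) = L.act_H (q c)" if "c \<in> carrier A.GP" for c
  proof -
    have "(\<Phi> \<circ> j) c = (L.act_H \<circ> q) c"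
      by (rule A.gp_hom_eqI[OF group_bij_group hom_compose[OF j_hom \<Phi>(1)] act_q that])
        (simp add: j_incl \<Phi>(2))
    then show ?thesis by simp
  qed
  have \<Phi>_shift: "\<Phi> y (L.shift z w) = L.shift z (\<Phi> y w)" if "y \<in> carrier GP" for y z w
    using that
  proof (induction y arbitrary: w rule: gp_induct)
    case one
    then show ?case by (simp add: \<Phi>_one)
  next
    case (mult u g y)
    then show ?case
      by (simp add: \<Phi>_mult \<Phi>(2) L.act_F_shift L.act_H_shift del: L.act_H.simps L.shift.simps)
  qed
  have \<Phi>_points: "\<Phi> y w \<in> L.points" if "y \<in> carrier GP" "w \<in> L.points" for y w
    using that(1)
  proof (induction y rule: gp_induct)
    case one
    then show ?case using that(2) by (simp add: \<Phi>_one)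
  next
    case (mult u g y)
    then show ?case
      using L.act_F_points[OF _ mult(4), of "qv g"] L.act_H_points[OF _ mult(4), of "q (A.\<iota> u g)"]
      by (cases "u = v") (simp_all add: \<Phi>_mult \<Phi>(2) del: L.act_H.simps)
  qed
  \<comment> \<open>In each syllable the vertex factor acts first and advances the position along
    the coset of \<open>Q k\<close>; the other factor then turns \<open>Q k\<close> into
    \<open>Q (Suc k)\<close>.\<close>
  have walk: "\<Phi> (ev (take k xs)) (0, \<one>\<^bsub>F\<^esub>, \<one>\<^bsub>H\<^esub>) = (int k, \<one>\<^bsub>F\<^esub>, Q k)" if "k \<le> n" for k
    using that
  proof (induction k)
    case 0
    then show ?case by (simp add: \<Phi>_one)
  next
    case (Suc k)
    then have k: "k < n" by simp
    have sub: "set (take k xs) \<subseteq> syllables" using xs(1) set_take_subset by fast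
    have "take (Suc k) xs = take k xs @ [(a k, t k)]"
      using k by (simp add: take_Suc_conv_app_nth n_def a_def t_def)
    then have "ev (take (Suc k) xs) = j (a k) \<otimes>\<^bsub>GP\<^esub> \<iota> v (t k) \<otimes>\<^bsub>GP\<^esub> ev (take k xs)"
      using sub k v_in by (simp add: ev_append)
    then have "\<Phi> (ev (take (Suc k) xs)) (0, \<one>\<^bsub>F\<^esub>, \<one>\<^bsub>H\<^esub>) =
        L.act_H (q (a k)) (L.act_F (qv (t k)) (int k, \<one>\<^bsub>F\<^esub>, Q k))"
      using Suc k sub v_in by (simp add: \<Phi>_mult \<Phi>_j \<Phi>(2) del: L.act_H.simps)
    also have "L.act_F (qv (t k)) (int k, \<one>\<^bsub>F\<^esub>, Q k) = (int k + 1, \<one>\<^bsub>F\<^esub>, Q k)"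
      using L.act_F_step[of "int k"] k by (simp add: s_def x_def)
    finally show ?case using k by (simp add: Q_Suc)
  qed
  show ?thesis
  proof (rule P.cyclic_virtual_retract_action[where \<Phi> = \<Phi> and T = L.shift and w = "(0, \<one>\<^bsub>F\<^esub>, \<one>\<^bsub>H\<^esub>)"
        and X = "{0..<int n} \<times> carrier F \<times> carrier H"])
    show "ev xs \<in> carrier GP" using xs(1) by simp
    show "\<Phi> (ev xs) (0, \<one>\<^bsub>F\<^esub>, \<one>\<^bsub>H\<^esub>) = L.shift 1 (0, \<one>\<^bsub>F\<^esub>, \<one>\<^bsub>H\<^esub>)"
    proof -
      \<comment> \<open>The end point has position \<open>n\<close> and coordinate
        \<open>Q n\<close>, which is the base point shifted by one period.\<close>
      have "take n xs = xs" by (simp add: n_def)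
      then show ?thesis using walk[of n] by simp
    qed
    show "z = 0" if "L.shift z (0, \<one>\<^bsub>F\<^esub>, \<one>\<^bsub>H\<^esub>) = (0, \<one>\<^bsub>F\<^esub>, \<one>\<^bsub>H\<^esub>)" for z
      using that n by simp
    show "finite ({0..<int n} \<times> carrier F \<times> carrier H)" using fin by simp
    fix y assume "y \<in> carrier GP"
    then show "\<exists>z. \<exists>p\<in>{0..<int n} \<times> carrier F \<times> carrier H. \<Phi> y (0, \<one>\<^bsub>F\<^esub>, \<one>\<^bsub>H\<^esub>) = L.shift z p"
      by (intro L.points_shift \<Phi>_points) auto
  qed (simp_all add: \<Phi>_one \<Phi>_mult \<Phi>_shift L.shift_zero L.shift_add del: L.shift.simps)
qed

section \<open>Shortening words by rotation\<close>

text \<open>A syllable with \<open>r a = a\<close> or trivial \<open>s\<close> can be rotated to an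
  end and merged with its neighbour, which shortens the word up to conjugacy. One-syllable words
  with such a syllable are handled directly.\<close>

lemma cyclic_virtual_retract_ev:
  assumes DA: "\<And>a. a \<in> carrier A.GP \<Longrightarrow> cyclic_virtual_retract A.GP a"
    and Dv: "\<And>s. s \<in> carrier (G v) \<Longrightarrow> cyclic_virtual_retract (G v) s"
    and xs: "set xs \<subseteq> syllables"
  shows "cyclic_virtual_retract GP (ev xs)"
  using xs
proof (induction xs rule: length_induct)
  case (1 xs)
  note xs = 1(2) and IH = 1(1)[rule_format]
  consider "xs = []" | "xs \<noteq> []" "\<And>a s. (a, s) \<in> set xs \<Longrightarrow> r a \<noteq> a \<and> s \<noteq> \<one>\<^bsub>G v\<^esub>"
    | a s where "(a, s) \<in> set xs" "r a = a" | a s where "(a, s) \<in> set xs" "s = \<one>\<^bsub>G v\<^esub>"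
    by blast
  then show ?case
  proof cases
    case 1
    then show ?thesis by (simp add: P.cyclic_virtual_retract_one)
  next
    case 2
    then show ?thesis using cyclic_virtual_retract_hyperbolic[OF DA Dv xs] by blast
  next
    case (3 a s)
    then obtain us ws where xs_eq: "xs = us @ (a, s) # ws" by (meson split_list)
    then have sub: "set (ws @ us) \<subseteq> syllables" using xs by simp
    \<comment> \<open>At the head of the list the syllable is the rightmost factor. Since
      \<open>a\<close> commutes with the vertex part of the next syllable, the two merge
      coordinatewise.\<close>
    have "cyclic_virtual_retract GP (ev (((a, s) # ws) @ us))"
    proof (cases "ws @ us")
      case Nil
      then show ?thesis
        using cyclic_virtual_retract_elliptic[of a s] 3 DA Dv xs xs_eq v_in by auto
    next
      case (Cons bt zs)
      obtain b t where bt: "bt = (b, t)" by (cases bt)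
      have mem: "a \<in> carrier A.GP" "s \<in> carrier (G v)" "b \<in> carrier A.GP" "t \<in> carrier (G v)" "set zs \<subseteq> syllables"
        using xs sub[unfolded Cons bt] by (auto simp: xs_eq)
      have "j b \<otimes>\<^bsub>GP\<^esub> \<iota> v t \<otimes>\<^bsub>GP\<^esub> (j a \<otimes>\<^bsub>GP\<^esub> \<iota> v s) = j (b \<otimes>\<^bsub>A.GP\<^esub> a) \<otimes>\<^bsub>GP\<^esub> \<iota> v (t \<otimes>\<^bsub>G v\<^esub> s)"
      proof -
        have "j b \<otimes>\<^bsub>GP\<^esub> \<iota> v t \<otimes>\<^bsub>GP\<^esub> (j a \<otimes>\<^bsub>GP\<^esub> \<iota> v s) = j b \<otimes>\<^bsub>GP\<^esub> (\<iota> v t \<otimes>\<^bsub>GP\<^esub> j a) \<otimes>\<^bsub>GP\<^esub> \<iota> v s"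
          using mem v_in by (simp add: P.m_assoc)
        also have "\<iota> v t \<otimes>\<^bsub>GP\<^esub> j a = j a \<otimes>\<^bsub>GP\<^esub> \<iota> v t"
          using j_r_commute[of a t] mem 3 by simp
        finally show ?thesis
          using mem v_in by (simp add: P.m_assoc hom_mult[OF gp_incl_hom])
      qed
      then have "ev ((a, s) # ws @ us) = ev ((b \<otimes>\<^bsub>A.GP\<^esub> a, t \<otimes>\<^bsub>G v\<^esub> s) # zs)"
        using Cons mem v_in by (simp add: bt P.m_assoc)
      moreover have "length (ws @ us) = Suc (length zs)" by (simp only: Cons list.size add_0_right plus_1_eq_Suc add_Suc_right)
      ultimately show ?thesis
        using IH[of "(b \<otimes>\<^bsub>A.GP\<^esub> a, t \<otimes>\<^bsub>G v\<^esub> s) # zs"] mem by (simp add: xs_eq)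
    qed
    then show ?thesis
      using cyclic_virtual_retract_rotate[of "(a, s) # ws" us] xs by (simp add: xs_eq)
  next
    case (4 a s)
    then obtain us ws where xs_eq: "xs = us @ (a, s) # ws" by (meson split_list)
    then have sub: "set (ws @ us) \<subseteq> syllables" using xs by simp
    \<comment> \<open>At the end of the list the syllable is the leftmost factor. With
      \<open>s\<close> trivial, \<open>a\<close> is absorbed into the preceding syllable.\<close>
    have "cyclic_virtual_retract GP (ev (ws @ (us @ [(a, s)])))"
    proof (cases "ws @ us" rule: rev_cases)
      case Nil
      have a: "a \<in> carrier A.GP" using xs by (simp add: xs_eq)
      \<comment> \<open>The map \<open>p\<close> retracts the graph product onto the image of
        \<open>j\<close>, so the claim comes from the smaller graph product.\<close>
      then have "cyclic_virtual_retract GP (j a)"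
        using cyclic_virtual_retract_pullback[OF P.is_group AP.is_group p_hom j_hom a p_j DA] by blast
      then show ?thesis using Nil 4 a v_in by simp
    next
      case (snoc zs bt)
      obtain b t where bt: "bt = (b, t)" by (cases bt)
      have mem: "a \<in> carrier A.GP" "b \<in> carrier A.GP" "t \<in> carrier (G v)" "set zs \<subseteq> syllables"
        using xs sub[unfolded snoc bt] by (auto simp: xs_eq)
      have eq: "ws @ us @ [(a, s)] = zs @ [(b, t), (a, s)]"
        using snoc by (metis append.assoc append_Cons append_Nil bt)
      have "ev (ws @ us @ [(a, s)]) = ev (zs @ [(a \<otimes>\<^bsub>A.GP\<^esub> b, t)])"
        unfolding eq using mem v_in 4 by (simp add: ev_append P.m_assoc)
      moreover have "length (ws @ us) = Suc (length zs)" by (simp only: snoc length_append list.size add_0_right plus_1_eq_Suc add_Suc_right)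
      ultimately show ?thesis
        using IH[of "zs @ [(a \<otimes>\<^bsub>A.GP\<^esub> b, t)]"] mem by (simp add: xs_eq)
    qed
    then show ?thesis
      using cyclic_virtual_retract_rotate[of ws "us @ [(a, s)]"] xs by (simp add: xs_eq)
  qed
qed

end

section \<open>Induction on the number of vertices\<close>

lemma (in graph_of_groups) cyclic_virtual_retract_graph_product:
  assumes "\<And>v s. v \<in> pverts \<Gamma> \<Longrightarrow> s \<in> carrier (G v) \<Longrightarrow> cyclic_virtual_retract (G v) s"
    and "x \<in> carrier GP"
  shows "cyclic_virtual_retract GP x"
  using graph_of_groups_axioms assms
proof (induction "card (pverts \<Gamma>)" arbitrary: \<Gamma> x)
  case (0 \<Gamma>)
  then interpret g: graph_of_groups \<Gamma> G by simp
  interpret P: group g.GP by (rule g.group_GP)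
  have "pverts \<Gamma> = {}" using 0 g.pair_finite_verts by simp
  \<comment> \<open>With no vertices there are no generators, so the graph product is
    trivial.\<close>
  with \<open>x \<in> carrier g.GP\<close> have "x = \<one>\<^bsub>g.GP\<^esub>"  by (induction rule: g.gp_induct) auto
  then show ?case by (simp add: P.cyclic_virtual_retract_one)
next
  case (Suc k \<Gamma>)
  then interpret g: graph_of_groups \<Gamma> G by simp
  obtain v where v: "v \<in> pverts \<Gamma>" using Suc.hyps(2) by fastforce
  obtain j p \<rho> r where "vertex_split \<Gamma> G v j p \<rho> r" using g.vertex_split_exists[OF v] by blast
  then interpret S: vertex_split \<Gamma> G v j p \<rho> r .
  obtain xs where xs: "set xs \<subseteq> carrier (graph_product (delete_vertex v \<Gamma>) G) \<times> carrier (G v)" "S.ev xs = x"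
    using S.ev_surj Suc.prems(3) by blast
  have "cyclic_virtual_retract (graph_product (delete_vertex v \<Gamma>) G) a"
    if "a \<in> carrier (graph_product (delete_vertex v \<Gamma>) G)" for a
  proof (rule Suc.hyps(1)[OF _ g.graph_of_groups_delete_vertex _ that])
    show "k = card (pverts (delete_vertex v \<Gamma>))"
      using Suc.hyps(2) v g.pair_finite_verts by simp
  qed (use Suc.prems(2) in simp)
  then show ?case using S.cyclic_virtual_retract_ev[OF _ Suc.prems(2)[OF v] xs(1)] xs(2) by simp
qed

theorem theorem7p1:
  fixes \<Gamma> :: "'v pair_pre_digraph" and G :: "'v \<Rightarrow> ('a, 'b) monoid_scheme"
  assumes "pair_graph \<Gamma>"
    and "\<And>v. v \<in> pverts \<Gamma> \<Longrightarrow> group (G v)"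
    and "\<And>v. v \<in> pverts \<Gamma> \<Longrightarrow> property_VRC (G v)"
  shows "property_VRC (graph_product \<Gamma> G)"
proof -
  interpret graph_of_groups \<Gamma> G
    using assms(1,2) by (simp add: graph_of_groups_def graph_of_groups_axioms_def)
  show ?thesis
  proof (rule group.VRC_I[OF group_GP])
    fix x assume "x \<in> carrier GP"
    then show "cyclic_virtual_retract GP x"
      using group.VRC_imp_cyclic_virtual_retract[OF assms(2,3)]
      by (rule cyclic_virtual_retract_graph_product[rotated])
  qed
qed

end
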